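(* Let $\alpha>-1$ and let $\Phi,\Psi:\mathbb{D}\to\mathbb{D}$ be analytic. Consider the composition operators $C_\Phi$ and $C_\Psi$ on the weighted Bergman space $\mathcal{A}_\alpha^2(\mathbb{D})$. If the product $C_\Phi^*C_\Psi$ is an isometry, then $\Phi(0)=0$ and $\Psi(0)=0$.
   Context: $\mathbb{D}=\{z\in\mathbb{C}:|z|<1\}$. For $\alpha>-1$, $\mathcal{A}_\alpha^2(\mathbb{D})$ is the Hilbert space of analytic functions $f:\mathbb{D}\to\mathbb{C}$ with $\|f\|_\alpha^2=\int_{\mathbb{D}}|f(z)|^2\,dA_\alpha(z)<\infty$, where $dA_\alpha(z)=(\alpha+1)(1-|z|^2)^\alpha\,dA(z)$ and $dA$ is area measure on $\mathbb{D}$ normalized so that $\mathbb{D}$ has measure $1$; the inner product is $\langle f,g\rangle=\int_{\mathbb{D}}f\overline{g}\,dA_\alpha$. For an analytic self-map $\Phi$ of $\mathbb{D}$, the composition operator is $C_\Phi f=f\circ\Phi$; it is a bounded operator on $\mathcal{A}_\alpha^2(\mathbb{D})$, and $C_\Phi^*$ denotes its Hilbert space adjoint. An operator $T$ is an isometry if $\|Tf\|_\alpha=\|f\|_\alpha$ for all $f$ (equivalently $T^*T=I$; surjectivity is not required). *)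

theory Defs
  imports "HOL-Analysis.Analysis" "HOL-Complex_Analysis.Complex_Analysis"
begin

abbreviation unit_disc :: "complex set" where
  "unit_disc \<equiv> ball 0 1"

definition disc_area :: "complex measure" where
  "disc_area = uniform_measure lborel unit_disc"

definition bergman_measure :: "real \<Rightarrow> complex measure" where
  "bergman_measure \<alpha> =
     density disc_area (\<lambda>z. ennreal ((\<alpha> + 1) * (1 - (norm z)\<^sup>2) powr \<alpha>))"

text \<open>
  Functions on the disc are represented by functions on the whole plane that vanish off the disc,
  so that distinct elements of the carrier are distinct functions on the disc.
\<close>

definition bergman_space :: "real \<Rightarrow> (complex \<Rightarrow> complex) set" where
  "bergman_space \<alpha> =
     {f. f holomorphic_on unit_disc \<and> (\<forall>z. z \<notin> unit_disc \<longrightarrow> f z = 0) \<and>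
         integrable (bergman_measure \<alpha>) (\<lambda>z. (norm (f z))\<^sup>2)}"

definition bergman_inner :: "real \<Rightarrow> (complex \<Rightarrow> complex) \<Rightarrow> (complex \<Rightarrow> complex) \<Rightarrow> complex" where
  "bergman_inner \<alpha> f g = (LINT z|bergman_measure \<alpha>. f z * cnj (g z))"

definition bergman_norm :: "real \<Rightarrow> (complex \<Rightarrow> complex) \<Rightarrow> real" where
  "bergman_norm \<alpha> f = sqrt (LINT z|bergman_measure \<alpha>. (norm (f z))\<^sup>2)"

definition composition_op ::
  "(complex \<Rightarrow> complex) \<Rightarrow> (complex \<Rightarrow> complex) \<Rightarrow> complex \<Rightarrow> complex" where
  "composition_op \<Phi> f = (\<lambda>z. if z \<in> unit_disc then f (\<Phi> z) else 0)"

text \<open>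
  The vector \<open>T* g\<close> is the element of the space representing the functional
  \<open>f \<mapsto> \<langle>T f, g\<rangle>\<close>. For \<open>\<alpha> > -1\<close> and \<open>T\<close> a bounded operator on the space, it exists and is
  unique; no value is specified for other \<open>T\<close>.
\<close>

definition bergman_adjoint ::
  "real \<Rightarrow> ((complex \<Rightarrow> complex) \<Rightarrow> complex \<Rightarrow> complex) \<Rightarrow> (complex \<Rightarrow> complex) \<Rightarrow> complex \<Rightarrow> complex"
  where
  "bergman_adjoint \<alpha> T g =
     (THE h. h \<in> bergman_space \<alpha> \<and>
        (\<forall>f\<in>bergman_space \<alpha>. bergman_inner \<alpha> (T f) g = bergman_inner \<alpha> f h))"

definition bergman_isometry ::
  "real \<Rightarrow> ((complex \<Rightarrow> complex) \<Rightarrow> complex \<Rightarrow> complex) \<Rightarrow> bool" where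
  "bergman_isometry \<alpha> T \<longleftrightarrow>
     (\<forall>f\<in>bergman_space \<alpha>. bergman_norm \<alpha> (T f) = bergman_norm \<alpha> f)"

end

theory Submission
  imports Defs
begin

text \<open>
  Let \<open>T = C\<^sub>\<Phi>\<^sup>* C\<^sub>\<Psi>\<close> be an isometry. Since \<open>C\<^sub>\<Phi> 1 = C\<^sub>\<Psi> 1 = 1\<close> and pairing with \<open>1\<close> is evaluation at \<open>0\<close>,
  \<open>f(\<Phi> 0) = \<langle>C\<^sub>\<Phi> f, 1\<rangle> = \<langle>f, T 1\<rangle>\<close> and \<open>f(\<Psi> 0) = \<langle>C\<^sub>\<Psi> f, 1\<rangle> = \<langle>T f, 1\<rangle>\<close> are both at most \<open>\<parallel>f\<parallel>\<close> in modulus.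
  Testing \<open>|f(w)| \<le> \<parallel>f\<parallel>\<close> on \<open>f(z) = 1 + cnj w z\<close> forces \<open>w = 0\<close>. The existence of the adjoint rests on
  the boundedness of \<open>C\<^sub>\<Phi>\<close>, which follows from Littlewood subordination on circles, and on a Riesz
  representation by power series, the monomials being orthogonal with norms given by the radial moments.
\<close>

section \<open>Means over the unit circle\<close>

text \<open>\<open>bergman_adjoint\<close> is a definite description, so the isometry hypothesis
  says nothing until the representing vector is known to exist and to be unique; most of the work
  serves that. The obstacle to boundedness is that \<Phi> need neither fix 0 nor extend to the
  closed disc, so subordination cannot compare a circle with itself. The circle of radius |z| is
  compared with a larger one whose radius R satisfies 1 - R^2 = c (1 - |z|^2), where c = (1 -
  |\<Phi>(0)|) / 2 comes from Schwarz-Pick. Returning from R to |z| is an affine substitution in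
  |z|^2 and costs only the factor c^(-(\<alpha>+1)), for every \<alpha> > -1. Two facts do the work
  of polar coordinates: rotation invariance, which allows circle means to be inserted under the area
  integral, and the uniform distribution of |z|^2 on [0,1] under normalized area. The final test
  function consists of the first two terms of the Szego kernel 1 / (1 - cnj w z). Its norm involves
  a single nontrivial moment, which is at most 1, so no closed form of the Bergman kernel is
  needed.\<close>

definition circle_point :: "real \<Rightarrow> complex" where "circle_point t = cis (2 * pi * t)"

lemma norm_circle_point [simp]: "norm (circle_point t) = 1" by (simp add: circle_point_def)

lemma circle_point_nonzero [simp]: "circle_point t \<noteq> 0" by (simp add: circle_point_def)

lemma continuous_on_circle_point [continuous_intros]:
  "continuous_on A f \<Longrightarrow> continuous_on A (\<lambda>x. circle_point (f x))"
  unfolding circle_point_def by (intro continuous_intros)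

text \<open>Cauchy's formula with d\<zeta> = 2 pi i \<zeta> dt. Parametrizing the circle by [0,1]
  makes integrals over \<open>{0..1}\<close> averages and agrees with
  \<open>circlepath 0 1\<close>.\<close>

lemma Cauchy_circle_mean:
  assumes f: "f holomorphic_on cball 0 1" and w: "norm w < 1"
  shows "((\<lambda>t. f (circle_point t) * circle_point t / (circle_point t - w)) has_integral f w) {0..1}"
proof -
  have "((\<lambda>u. f u / (u - w)) has_contour_integral (2 * of_real pi * \<i> * f w)) (circlepath 0 1)"
    using Cauchy_integral_circlepath_simple[OF f, of w] w by simp
  then have "((\<lambda>x. f (circlepath 0 1 x) / (circlepath 0 1 x - w) *
       vector_derivative (circlepath 0 1) (at x within {0..1})) has_integral 2 * of_real pi * \<i> * f w) {0..1}"
    by (simp add: has_contour_integral_def)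
  then have "((\<lambda>x. f (circle_point x) / (circle_point x - w) * (2 * of_real pi * \<i> * circle_point x))
      has_integral 2 * of_real pi * \<i> * f w) {0..1}"
    by (rule has_integral_eq[rotated])
       (simp add: vector_derivative_circlepath01, simp add: circlepath circle_point_def cis_conv_exp mult_ac)
  from has_integral_mult_right[OF this, of "1 / (2 * of_real pi * \<i>)"]
  show ?thesis by (simp add: field_simps)
qed

lemma holomorphic_circle_mean:
  assumes "f holomorphic_on cball 0 1"
  shows "((\<lambda>t. f (circle_point t)) has_integral f 0) {0..1}"
  using Cauchy_circle_mean[OF assms, of 0] by simp

section \<open>The Poisson kernel and subordination\<close>

definition poisson_kernel :: "complex \<Rightarrow> complex \<Rightarrow> real" where
  "poisson_kernel w \<zeta> = (1 - (norm w)\<^sup>2) / (norm (\<zeta> - w))\<^sup>2"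

lemma poisson_kernel_nonneg: "norm w < 1 \<Longrightarrow> 0 \<le> poisson_kernel w \<zeta>"
  by (simp add: poisson_kernel_def power_le_one)

text \<open>On the circle 1 - |w|^2 = |\<zeta>|^2 - |w|^2 is the real part of (\<zeta> + w) cnj
  (\<zeta> - w). This exhibits the kernel as the real part of a function holomorphic in w, which is
  how its mean over t is computed in \<open>Littlewood_circle\<close>.\<close>

lemma poisson_kernel_conv_Re:
  assumes "norm \<zeta> = 1"
  shows "poisson_kernel w \<zeta> = Re ((\<zeta> + w) / (\<zeta> - w))"
proof -
  have "Re \<zeta> * Re \<zeta> + Im \<zeta> * Im \<zeta> = 1"
    using assms cmod_power2[of \<zeta>] by (simp add: power2_eq_square)
  then have "1 - (norm w)\<^sup>2 = Re (\<zeta> + w) * Re (\<zeta> - w) + Im (\<zeta> + w) * Im (\<zeta> - w)"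
    unfolding cmod_power2 by (simp add: power2_eq_square algebra_simps)
  then show ?thesis
    by (simp add: poisson_kernel_def Re_divide cmod_power2)
qed

lemma poisson_kernel_le:
  assumes "norm \<zeta> = 1" "norm w < 1"
  shows "poisson_kernel w \<zeta> \<le> 2 / (1 - norm w)"
proof -
  have "1 - norm w \<le> norm (\<zeta> - w)"
    using norm_triangle_ineq2[of \<zeta> w] assms by simp
  then have "poisson_kernel w \<zeta> \<le> (1 - (norm w)\<^sup>2) / (1 - norm w)\<^sup>2"
    unfolding poisson_kernel_def using assms by (intro divide_left_mono power_mono mult_pos_pos) (auto simp: power_le_one)
  also have "\<dots> = (1 + norm w) / (1 - norm w)"
  proof -
    have "1 - (norm w)\<^sup>2 = (1 + norm w) * (1 - norm w)" by (simp add: power2_eq_square algebra_simps)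
    then show ?thesis using assms by (simp add: power2_eq_square)
  qed
  also have "\<dots> \<le> 2 / (1 - norm w)"
    using assms by (intro divide_right_mono) auto
  finally show ?thesis .
qed

lemma continuous_on_poisson_kernel [continuous_intros]:
  assumes "continuous_on A f" "continuous_on A g" "\<And>x. x \<in> A \<Longrightarrow> f x \<noteq> g x"
  shows "continuous_on A (\<lambda>x. poisson_kernel (f x) (g x))"
  unfolding poisson_kernel_def using assms(3) by (intro continuous_intros assms(1,2)) fastforce

text \<open>Cauchy's formula is applied to f multiplied by (1 - |w|^2) / (1 - cnj w \<zeta>), a
  factor that equals 1 at w and has no pole in the closed disc. On the circle 1 - cnj w \<zeta> =
  \<zeta> cnj (\<zeta> - w), and the Cauchy kernel turns into the Poisson kernel.\<close>

lemma Poisson_circle_mean: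
  assumes f: "f holomorphic_on cball 0 1" and w: "norm w < 1"
  shows "((\<lambda>t. f (circle_point t) * of_real (poisson_kernel w (circle_point t))) has_integral f w) {0..1}"
proof -
  define g where "g \<zeta> = f \<zeta> * of_real (1 - (norm w)\<^sup>2) / (1 - cnj w * \<zeta>)" for \<zeta>
  have ne: "1 - cnj w * \<zeta> \<noteq> 0" if "norm \<zeta> \<le> 1" for \<zeta>
  proof
    assume "1 - cnj w * \<zeta> = 0"
    then have "norm w * norm \<zeta> = 1"
      by (metis complex_mod_cnj eq_iff_diff_eq_0 norm_mult norm_one)
    moreover have "norm w * norm \<zeta> \<le> norm w * 1"
      using that by (intro mult_left_mono) auto
    ultimately show False using w by linarith
  qed
  have "g holomorphic_on cball 0 1"
    unfolding g_def using ne by (intro holomorphic_intros f) auto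
  from Cauchy_circle_mean[OF this w]
  have "((\<lambda>t. g (circle_point t) * circle_point t / (circle_point t - w)) has_integral g w) {0..1}" .
  moreover have "g w = f w"
  proof -
    have "1 - cnj w * w = of_real (1 - (norm w)\<^sup>2)"
      using complex_norm_square[of w] by (simp add: mult.commute)
    then show ?thesis using ne[of w] w unfolding g_def by simp
  qed
  moreover have "g (circle_point t) * circle_point t / (circle_point t - w) = f (circle_point t) * of_real (poisson_kernel w (circle_point t))" for t
  proof -
    have *: "circle_point t * cnj (circle_point t) = 1"
      using complex_norm_square[of "circle_point t"] by simp
    have "1 - cnj w * circle_point t = circle_point t * cnj (circle_point t - w)"
      by (simp add: algebra_simps *)
    moreover have "(of_real ((norm (circle_point t - w))\<^sup>2) :: complex) = (circle_point t - w) * cnj (circle_point t - w)"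
      using complex_norm_square by simp
    ultimately show ?thesis
      by (simp add: g_def poisson_kernel_def del: complex_cnj_diff)
  qed
  ultimately show ?thesis by simp
qed

lemma norm_square_le_poisson_mean:
  assumes f: "f holomorphic_on cball 0 1" and w: "norm w < 1"
  shows "(norm (f w))\<^sup>2 \<le> integral {0..1} (\<lambda>t. (norm (f (circle_point t)))\<^sup>2 * poisson_kernel w (circle_point t))"
proof -
  have cf: "continuous_on {0..1} (\<lambda>t. f (circle_point t))"
    by (rule continuous_on_compose2[OF holomorphic_on_imp_continuous_on[OF f]])
       (auto intro!: continuous_intros)
  have ne: "circle_point t \<noteq> w" for t using w norm_circle_point[of t] by auto
  \<comment> \<open>The Poisson formula for \<open>f\<^sup>2\<close>, rather than for \<open>f\<close>, makes convexity of the square superfluous.\<close>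
  have "(\<lambda>z. (f z)\<^sup>2) holomorphic_on cball 0 1"
    by (intro holomorphic_intros f)
  note * = Poisson_circle_mean[OF this w]
  have "(norm (f w))\<^sup>2 = norm ((f w)\<^sup>2)" by (simp add: norm_power)
  also have "\<dots> = norm (integral {0..1} (\<lambda>t. (f (circle_point t))\<^sup>2 * of_real (poisson_kernel w (circle_point t))))"
    using * by (simp add: integral_unique)
  also have "\<dots> \<le> integral {0..1} (\<lambda>t. (norm (f (circle_point t)))\<^sup>2 * poisson_kernel w (circle_point t))"
    using * ne poisson_kernel_nonneg[OF w]
    by (intro integral_norm_bound_integral integrable_continuous_real continuous_intros cf)
       (auto simp: norm_mult norm_power has_integral_integrable)
  finally show ?thesis .
qed

text \<open>
  Littlewood subordination: \<open>|g(w)|\<^sup>2\<close> is at most the Poisson mean of \<open>|g|\<^sup>2\<close>, and for fixed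
  \<open>\<zeta>\<close> on the circle \<open>z \<mapsto> P(\<phi> z, \<zeta>)\<close> is harmonic, so its mean is \<open>P(\<phi> 0, \<zeta>)\<close>.
\<close>

lemma Littlewood_circle:
  assumes g: "g holomorphic_on cball 0 1" and \<phi>: "\<phi> holomorphic_on cball 0 1"
    and sub: "\<And>z. norm z \<le> 1 \<Longrightarrow> norm (\<phi> z) < 1"
  shows "integral {0..1} (\<lambda>t. (norm (g (\<phi> (circle_point t))))\<^sup>2) \<le>
    2 / (1 - norm (\<phi> 0)) * integral {0..1} (\<lambda>t. (norm (g (circle_point t)))\<^sup>2)"
proof -
  have cg: "continuous_on A (\<lambda>x. g (k x))" if "continuous_on A k" "\<And>x. x \<in> A \<Longrightarrow> norm (k x) \<le> 1"
    for A :: "'x::topological_space set" and k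
    using that by (intro continuous_on_compose2[OF holomorphic_on_imp_continuous_on[OF g]]) auto
  have c\<phi>: "continuous_on A (\<lambda>x. \<phi> (k x))" if "continuous_on A k" "\<And>x. x \<in> A \<Longrightarrow> norm (k x) \<le> 1"
    for A :: "'x::topological_space set" and k
    using that by (intro continuous_on_compose2[OF holomorphic_on_imp_continuous_on[OF \<phi>]]) auto
  \<comment> \<open>The closed disc goes into the open disc, so the kernel's denominator never
    vanishes on the parameter square. The resulting joint continuity permits the exchange of
    integrals below.\<close>
  have ne: "\<phi> z \<noteq> circle_point s" "circle_point s \<noteq> \<phi> z" if "norm z \<le> 1" for z s
    using sub[OF that] norm_circle_point[of s] by force+
  let ?F = "\<lambda>t s. (norm (g (circle_point s)))\<^sup>2 * poisson_kernel (\<phi> (circle_point t)) (circle_point s)"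
  have cont: "continuous_on A (\<lambda>x. ?F (j x) (k x))" if "continuous_on A j" "continuous_on A k"
    for A :: "'x::topological_space set" and j k
    using that ne by (intro continuous_intros cg c\<phi>) auto
  have cont2: "continuous_on (cbox (0, 0) (1, 1)) (\<lambda>(t, s). ?F t s)"
    unfolding case_prod_beta by (intro cont continuous_intros)
  have "integral {0..1} (\<lambda>t. (norm (g (\<phi> (circle_point t))))\<^sup>2) \<le> integral {0..1} (\<lambda>t. integral {0..1} (?F t))"
  proof (intro integral_le integrable_continuous_real)
    show "continuous_on {0..1} (\<lambda>t. (norm (g (\<phi> (circle_point t))))\<^sup>2)"
      using sub by (intro continuous_intros cg c\<phi>) (auto intro: less_imp_le)
    show "continuous_on {0..1} (\<lambda>t. integral {0..1} (?F t))"
      using integral_continuous_on_param[of "{0..1}" 0 1 ?F] cont2 by (simp add: cbox_Pair_eq)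
  qed (use norm_square_le_poisson_mean[OF g] sub in auto)
  also have "\<dots> = integral {0..1} (\<lambda>s. integral {0..1} (\<lambda>t. ?F t s))"
    using integral_swap_continuous[OF cont2] by simp
  also have "\<dots> = integral {0..1} (\<lambda>s. (norm (g (circle_point s)))\<^sup>2 * poisson_kernel (\<phi> 0) (circle_point s))"
  proof (intro integral_cong)
    fix s :: real
    have "(\<lambda>z. (circle_point s + \<phi> z) / (circle_point s - \<phi> z)) holomorphic_on cball 0 1"
      using ne by (intro holomorphic_intros \<phi>) auto
    from has_integral_linear[OF holomorphic_circle_mean[OF this] bounded_linear_Re]
    have "((\<lambda>t. poisson_kernel (\<phi> (circle_point t)) (circle_point s)) has_integral poisson_kernel (\<phi> 0) (circle_point s)) {0..1}"
      by (simp add: poisson_kernel_conv_Re o_def)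
    from has_integral_mult_right[OF this, of "(norm (g (circle_point s)))\<^sup>2"]
    show "integral {0..1} (\<lambda>t. ?F t s) = (norm (g (circle_point s)))\<^sup>2 * poisson_kernel (\<phi> 0) (circle_point s)"
      by (rule integral_unique)
  qed
  also have "\<dots> \<le> integral {0..1} (\<lambda>s. 2 / (1 - norm (\<phi> 0)) * (norm (g (circle_point s)))\<^sup>2)"
    using ne[of 0] poisson_kernel_le[OF norm_circle_point sub[of 0]]
    by (intro integral_le integrable_continuous_real continuous_intros cg)
       (auto simp: mult.commute[of "2 / _"] simp del: times_divide_eq_left times_divide_eq_right intro: mult_left_mono)
  finally show ?thesis by simp
qed

section \<open>Orthogonality of powers and Parseval on the circle\<close>

text \<open>On the circle conjugation is inversion, so the product is a power with exponent |n - m|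
  or the conjugate of one, and its mean is the value of that power at 0.\<close>

lemma circle_point_power_mean:
  "((\<lambda>t. circle_point t ^ n * cnj (circle_point t ^ m)) has_integral (if n = m then 1 else 0)) {0..1}"
proof -
  have *: "((\<lambda>t. circle_point t ^ k) has_integral (if k = 0 then 1 else 0)) {0..1}" for k
    using holomorphic_circle_mean[of "\<lambda>z. z ^ k"] by (auto simp: holomorphic_intros power_0_left)
  have **: "circle_point t ^ j * cnj (circle_point t) ^ j = 1" for t j
    using complex_norm_square[of "circle_point t"] by (simp flip: power_mult_distrib)
  show ?thesis
  proof (cases "m \<le> n")
    case True
    then have "circle_point t ^ n * cnj (circle_point t ^ m) = circle_point t ^ (n - m)" for t
      using **[of t m] by (simp add: power_add[of _ "n - m" m, simplified True le_add_diff_inverse2] mult.assoc)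
    then show ?thesis using *[of "n - m"] True by auto
  next
    case False
    then have "circle_point t ^ n * cnj (circle_point t ^ m) = cnj (circle_point t ^ (m - n))" for t
      using **[of t n] power_add[of "cnj (circle_point t)" "m - n" n] by simp
    moreover have "((\<lambda>t. cnj (circle_point t ^ (m - n))) has_integral 0) {0..1}"
      using has_integral_linear[OF *[of "m - n"] bounded_linear_cnj] False by (simp add: o_def)
    ultimately show ?thesis using False by simp
  qed
qed

lemma Parseval_circle_finite:
  "((\<lambda>t. (norm (\<Sum>n<N. b n * circle_point t ^ n))\<^sup>2) has_integral (\<Sum>n<N. (norm (b n))\<^sup>2)) {0..1}"
proof -
  have "((\<lambda>t. \<Sum>n<N. \<Sum>m<N. b n * cnj (b m) * (circle_point t ^ n * cnj (circle_point t ^ m))) has_integral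
     (\<Sum>n<N. \<Sum>m<N. b n * cnj (b m) * (if n = m then 1 else 0))) {0..1}"
    by (intro has_integral_sum has_integral_mult_right circle_point_power_mean) auto
  moreover have "(\<Sum>n<N. \<Sum>m<N. b n * cnj (b m) * (circle_point t ^ n * cnj (circle_point t ^ m))) =
      of_real ((norm (\<Sum>n<N. b n * circle_point t ^ n))\<^sup>2)" for t
    by (simp only: complex_norm_square cnj_sum sum_product) (simp add: mult_ac)
  moreover have "(\<Sum>n<N. \<Sum>m<N. b n * cnj (b m) * (if n = m then 1 else 0)) =
      of_real (\<Sum>n<N. (norm (b n))\<^sup>2)"
    by (simp add: complex_norm_square if_distrib[of "\<lambda>x. _ * x"] cong: if_cong del: of_real_power)
  ultimately have "((\<lambda>t. complex_of_real ((norm (\<Sum>n<N. b n * circle_point t ^ n))\<^sup>2)) has_integral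
      of_real (\<Sum>n<N. (norm (b n))\<^sup>2)) {0..1}"
    by (simp only:)
  from has_integral_linear[OF this bounded_linear_Re] show ?thesis by (simp add: o_def)
qed

text \<open>Absolute summability supplies the constant dominating function that carries the finite
  identity to the limit; summability of the squares comes out of the same convergence.\<close>

lemma Parseval_circle:
  assumes b: "summable (\<lambda>n. norm (b n))"
  shows "((\<lambda>t. (norm (\<Sum>n. b n * circle_point t ^ n))\<^sup>2) has_integral (\<Sum>n. (norm (b n))\<^sup>2)) {0..1}"
    and "summable (\<lambda>n. (norm (b n))\<^sup>2)"
proof -
  let ?S = "\<lambda>N t. (norm (\<Sum>n<N. b n * circle_point t ^ n))\<^sup>2" and ?T = "\<lambda>t. (norm (\<Sum>n. b n * circle_point t ^ n))\<^sup>2"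
  have sm: "summable (\<lambda>n. b n * circle_point t ^ n)" for t
    by (rule summable_norm_cancel) (simp add: norm_mult norm_power b)
  have lim: "(\<lambda>N. ?S N t) \<longlonglongrightarrow> ?T t" for t
    by (intro tendsto_power tendsto_norm summable_LIMSEQ sm)
  have bd: "norm (?S N t) \<le> (\<Sum>n. norm (b n))\<^sup>2" for N t
  proof -
    have "norm (\<Sum>n<N. b n * circle_point t ^ n) \<le> (\<Sum>n<N. norm (b n))"
      by (rule sum_norm_le) (simp add: norm_mult norm_power)
    also have "\<dots> \<le> (\<Sum>n. norm (b n))" using b by (intro sum_le_suminf) auto
    finally show ?thesis by (simp add: power_mono)
  qed
  have int: "?S N integrable_on {0..1}" for N
    using Parseval_circle_finite by (rule has_integral_integrable)
  have T: "?T integrable_on {0..1}" "(\<lambda>N. integral {0..1} (?S N)) \<longlonglongrightarrow> integral {0..1} ?T"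
    using dominated_convergence[where f = ?S and g = ?T and S = "{0..1}" and h = "\<lambda>_. (\<Sum>n. norm (b n))\<^sup>2"]
      int bd lim by (blast intro: integrable_const_ivl)+
  then have sums: "(\<lambda>n. (norm (b n))\<^sup>2) sums integral {0..1} ?T"
    by (simp add: sums_def integral_unique[OF Parseval_circle_finite])
  show "summable (\<lambda>n. (norm (b n))\<^sup>2)" using sums by (rule sums_summable)
  show "(?T has_integral (\<Sum>n. (norm (b n))\<^sup>2)) {0..1}"
    using T(1) sums by (simp add: sums_unique[symmetric] integrable_integral)
qed

section \<open>The Bergman measure\<close>

lemma nn_integral_lborel_plus:
  fixes c :: "'a::euclidean_space"
  assumes [measurable]: "f \<in> borel_measurable borel"
  shows "(\<integral>\<^sup>+x. f (c + x) \<partial>lborel) = (\<integral>\<^sup>+x. f x \<partial>lborel)"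
  by (subst (2) lborel_distr_plus[of c, symmetric]) (simp add: nn_integral_distr)

lemma nn_integral_lborel_minus:
  fixes c :: "'a::euclidean_space"
  assumes [measurable]: "f \<in> borel_measurable borel"
  shows "(\<integral>\<^sup>+x. f (c - x) \<partial>lborel) = (\<integral>\<^sup>+x. f x \<partial>lborel)"
proof -
  have "(lborel :: 'a measure) = density (distr lborel borel (\<lambda>x. c - x)) (\<lambda>_. 1)"
    using lborel_affine[of "-1" c] by simp
  then have "(\<integral>\<^sup>+x. f x \<partial>lborel) = (\<integral>\<^sup>+x. f x \<partial>density (distr lborel borel (\<lambda>x. c - x)) (\<lambda>_. 1))"
    by simp
  then show ?thesis by (simp add: nn_integral_density nn_integral_distr)
qed

lemma unit_disc_borel [measurable]: "unit_disc \<in> sets borel"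
  by simp

text \<open>
  Both integrals of \<open>(x, y) \<mapsto> 1\<^sub>A(u x) 1\<^sub>B(y)\<close> and \<open>(x, y) \<mapsto> 1\<^sub>A(y) 1\<^sub>B(u x)\<close> agree by translations
  and a reflection alone; the unit disc \<open>B\<close> is invariant under \<open>u\<close> and can be cancelled.
\<close>

lemma lborel_distr_rotation:
  fixes u :: complex
  assumes u: "norm u = 1"
  shows "distr lborel borel ((*) u) = lborel"
proof (rule measure_eqI)
  fix A :: "complex set" assume "A \<in> sets (distr lborel borel ((*) u))"
  then have A[measurable]: "A \<in> sets borel" by simp
  have u0: "u \<noteq> 0" using u by auto
  let ?B = "ball 0 1 :: complex set"
  let ?a = "indicator A :: complex \<Rightarrow> ennreal" and ?b = "indicator ?B :: complex \<Rightarrow> ennreal"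
  \<comment> \<open>Positive and finite measure is what allows the disc to be cancelled at the
    end.\<close>
  have B: "0 < emeasure lborel ?B" "emeasure lborel ?B < \<infinity>"
    by (simp_all add: emeasure_ball unit_ball_vol_pos)
  have "(\<integral>\<^sup>+x. ?a (u * x) \<partial>lborel) * emeasure lborel ?B = (\<integral>\<^sup>+x. \<integral>\<^sup>+y. ?a (u * x) * ?b y \<partial>lborel \<partial>lborel)"
    by (simp add: nn_integral_cmult_indicator nn_integral_multc)
  also have "\<dots> = (\<integral>\<^sup>+x. \<integral>\<^sup>+y. ?a (u * x) * ?b (u * x + y) \<partial>lborel \<partial>lborel)"
    by (rule nn_integral_cong, rule nn_integral_lborel_plus[where f = "\<lambda>y. ?a _ * ?b y", symmetric], measurable)
  also have "\<dots> = (\<integral>\<^sup>+y. \<integral>\<^sup>+x. ?a (u * x) * ?b (u * x + y) \<partial>lborel \<partial>lborel)"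
    by (rule lborel_pair.Fubini') simp
  \<comment> \<open>Shifting x by - y / u turns u x + y into u x and moves y into the argument of
    the indicator of A.\<close>
  also have "\<dots> = (\<integral>\<^sup>+y. \<integral>\<^sup>+x. ?a (u * (- y / u + x)) * ?b (u * (- y / u + x) + y) \<partial>lborel \<partial>lborel)"
    by (rule nn_integral_cong,
        rule nn_integral_lborel_plus[where f = "\<lambda>x. ?a (u * x) * ?b (u * x + _)", symmetric], measurable)
  also have "\<dots> = (\<integral>\<^sup>+y. \<integral>\<^sup>+x. ?a (u * x - y) * ?b (u * x) \<partial>lborel \<partial>lborel)"
    using u0 by (simp add: ring_distribs)
  also have "\<dots> = (\<integral>\<^sup>+x. \<integral>\<^sup>+y. ?a (u * x - y) * ?b (u * x) \<partial>lborel \<partial>lborel)"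
    by (rule lborel_pair.Fubini') simp
  also have "\<dots> = (\<integral>\<^sup>+x. \<integral>\<^sup>+y. ?a y * ?b (u * x) \<partial>lborel \<partial>lborel)"
    by (rule nn_integral_cong, rule nn_integral_lborel_minus[where f = "\<lambda>y. ?a y * ?b _"], measurable)
  also have "\<dots> = (\<integral>\<^sup>+x. emeasure lborel A * ?b x \<partial>lborel)"
    using u by (intro nn_integral_cong) (simp add: nn_integral_multc indicator_def[of unit_disc] norm_mult)
  also have "\<dots> = emeasure lborel A * emeasure lborel ?B"
    by (simp add: nn_integral_cmult)
  finally have "(\<integral>\<^sup>+x. ?a (u * x) \<partial>lborel) = emeasure lborel A"
    using B by (metis ennreal_mult_divide_eq infinity_ennreal_def less_irrefl)
  moreover have "emeasure (distr lborel borel ((*) u)) A = (\<integral>\<^sup>+x. ?a (u * x) \<partial>lborel)"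
    using nn_integral_distr[of "(*) u" lborel borel ?a] by simp
  ultimately show "emeasure (distr lborel borel ((*) u)) A = emeasure lborel A"
    by simp
qed simp

lemma emeasure_unit_disc: "emeasure lborel unit_disc = ennreal pi"
  by (simp add: emeasure_ball unit_ball_vol_2 flip: One_nat_def)

lemma sets_disc_area [simp, measurable_cong]: "sets disc_area = sets borel"
  and space_disc_area [simp]: "space disc_area = UNIV"
  by (simp_all add: disc_area_def)

lemma sets_bergman_measure [simp, measurable_cong]: "sets (bergman_measure \<alpha>) = sets borel"
  and space_bergman_measure [simp]: "space (bergman_measure \<alpha>) = UNIV"
  by (simp_all add: bergman_measure_def)

lemma nn_integral_bergman_measure:
  assumes [measurable]: "f \<in> borel_measurable borel"
  shows "(\<integral>\<^sup>+z. f z \<partial>bergman_measure \<alpha>) =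
    (\<integral>\<^sup>+z. ennreal ((\<alpha> + 1) * (1 - (norm z)\<^sup>2) powr \<alpha>) * f z \<partial>disc_area)"
  by (simp add: bergman_measure_def nn_integral_density)

lemma AE_bergman_measure: "AE z in bergman_measure \<alpha>. z \<in> unit_disc"
proof -
  have "AE z in disc_area. z \<in> unit_disc"
    unfolding disc_area_def by (rule AE_uniform_measureI) auto
  then show ?thesis unfolding bergman_measure_def by (subst AE_density) auto
qed

text \<open>The weight and the indicator of the disc depend on |z| only, so the rotation invariance
  of Lebesgue measure is inherited.\<close>

lemma nn_integral_bergman_rotation:
  assumes [measurable]: "f \<in> borel_measurable borel" and u: "norm u = 1"
  shows "(\<integral>\<^sup>+z. f (u * z) \<partial>bergman_measure \<alpha>) = (\<integral>\<^sup>+z. f z \<partial>bergman_measure \<alpha>)"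
proof -
  have *: "(\<integral>\<^sup>+z. g z \<partial>bergman_measure \<alpha>) =
      (\<integral>\<^sup>+z. ennreal ((\<alpha> + 1) * (1 - (norm z)\<^sup>2) powr \<alpha>) * g z * indicator unit_disc z \<partial>lborel) / ennreal pi"
    if [measurable]: "g \<in> borel_measurable borel" for g
    by (simp add: nn_integral_bergman_measure disc_area_def nn_integral_uniform_measure emeasure_unit_disc)
  let ?w = "\<lambda>z. ennreal ((\<alpha> + 1) * (1 - (norm z)\<^sup>2) powr \<alpha>) * f z * indicator unit_disc z"
  have "(\<integral>\<^sup>+z. ?w z \<partial>lborel) = (\<integral>\<^sup>+z. ?w (u * z) \<partial>lborel)"
  proof -
    have "(\<integral>\<^sup>+z. ?w z \<partial>lborel) = (\<integral>\<^sup>+z. ?w z \<partial>distr lborel borel ((*) u))"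
      by (simp only: lborel_distr_rotation[OF u])
    also have "\<dots> = (\<integral>\<^sup>+z. ?w (u * z) \<partial>lborel)"
      by (rule nn_integral_distr) simp_all
    finally show ?thesis .
  qed
  also have "\<dots> = (\<integral>\<^sup>+z. ennreal ((\<alpha> + 1) * (1 - (norm z)\<^sup>2) powr \<alpha>) * f (u * z) * indicator unit_disc z \<partial>lborel)"
    using u by (simp add: norm_mult indicator_def)
  finally show ?thesis by (simp add: *)
qed

text \<open>The disc of radius sqrt x has area pi x, hence normalized area x. Comparing the measures
  of all upper rays suffices.\<close>

lemma distr_disc_area_norm_square:
  "distr disc_area borel (\<lambda>z. (norm z)\<^sup>2) = uniform_measure lborel {0..1::real}" (is "?M = ?N")
proof (rule measure_eqI_lessThan)
  have disc_cball: "emeasure lborel (cball 0 r :: complex set) = ennreal (pi * r\<^sup>2)" if "0 \<le> r" for r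
    using that by (simp add: emeasure_cball unit_ball_vol_2 ennreal_mult flip: One_nat_def)
  fix x :: real
  have "emeasure ?M {x<..} = emeasure lborel (unit_disc \<inter> {z. x < (norm z)\<^sup>2}) / ennreal pi"
    by (simp add: emeasure_distr disc_area_def vimage_def emeasure_unit_disc)
  also have "\<dots> = emeasure lborel ({0..1} \<inter> {x<..})"
  proof -
    consider "x < 0" | "0 \<le> x" "x < 1" | "1 \<le> x" by linarith
    then show ?thesis
    proof cases
      case 1
      then have "unit_disc \<inter> {z. x < (norm z)\<^sup>2} = unit_disc"
        by (auto intro: less_le_trans[OF _ zero_le_power2])
      moreover have "{0..1} \<inter> {x<..} = {0..1}" using 1 by auto
      ultimately show ?thesis by (simp add: emeasure_unit_disc ennreal_divide_self)
    next
      case 2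
      have "unit_disc \<inter> {z. x < (norm z)\<^sup>2} = unit_disc - cball 0 (sqrt x)"
      proof -
        have *: "x < (norm z)\<^sup>2 \<longleftrightarrow> sqrt x < norm z" for z :: complex
          using real_sqrt_less_iff[of x "(norm z)\<^sup>2"] by simp
        show ?thesis by (simp only: set_eq_iff Int_iff Diff_iff mem_Collect_eq mem_cball_0 * not_le simp_thms)
      qed
      moreover have "emeasure lborel (unit_disc - cball 0 (sqrt x)) = ennreal pi - ennreal (pi * x)"
      proof -
        have "cball 0 (sqrt x) \<subseteq> (unit_disc :: complex set)"
          using 2 by (intro cball_subset_ball_iff[THEN iffD2] disjI1) simp
        then show ?thesis
          using 2 disc_cball[of "sqrt x"] by (subst emeasure_Diff) (auto simp: emeasure_unit_disc)
      qed
      moreover have "(ennreal pi - ennreal (pi * x)) / ennreal pi = ennreal (1 - x)"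
      proof -
        have "(ennreal pi - ennreal (pi * x)) / ennreal pi = ennreal ((pi - pi * x) / pi)"
          using 2 by (subst ennreal_minus) (simp_all add: divide_ennreal mult_left_le)
        also have "(pi - pi * x) / pi = 1 - x" by (simp add: diff_divide_distrib)
        finally show ?thesis .
      qed
      moreover have "{0..1} \<inter> {x<..} = {x<..1}" using 2 by auto
      ultimately show ?thesis using 2 by simp
    next
      case 3
      have "unit_disc \<inter> {z. x < (norm z)\<^sup>2} = {}"
      proof -
        have "\<not> x < (norm z)\<^sup>2" if "norm z < 1" for z :: complex
          using power_le_one[of "norm z" 2] that 3 by simp
        then show ?thesis by auto
      qed
      moreover have "{0..1} \<inter> {x<..} = {}" using 3 by auto
      ultimately show ?thesis by (simp del: Int_emptyI)
    qed
  qed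
  also have "\<dots> = emeasure ?N {x<..}" by (simp add: divide_ennreal_def)
  finally show "emeasure ?M {x<..} = emeasure ?N {x<..}" .
  have "emeasure lborel ({0..1} \<inter> {x<..}) \<le> emeasure lborel {0..1::real}"
    by (intro emeasure_mono) auto
  also have "\<dots> < \<infinity>" by simp
  finally show "emeasure ?M {x<..} < \<infinity>"
    using \<open>emeasure ?M {x<..} = emeasure ?N {x<..}\<close> by (simp add: divide_ennreal_def)
qed simp_all

text \<open>The weight is itself a function of x = |z|^2, so the whole integral passes through the
  push-forward to [0,1].\<close>

lemma nn_integral_bergman_radial:
  assumes [measurable]: "g \<in> borel_measurable borel"
  shows "(\<integral>\<^sup>+z. g ((norm z)\<^sup>2) \<partial>bergman_measure \<alpha>) =
    (\<integral>\<^sup>+x. ennreal ((\<alpha> + 1) * (1 - x) powr \<alpha>) * g x * indicator {0..1} x \<partial>lborel)"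
proof -
  have "(\<integral>\<^sup>+z. g ((norm z)\<^sup>2) \<partial>bergman_measure \<alpha>) =
      (\<integral>\<^sup>+x. ennreal ((\<alpha> + 1) * (1 - x) powr \<alpha>) * g x \<partial>distr disc_area borel (\<lambda>z. (norm z)\<^sup>2))"
    by (simp add: nn_integral_bergman_measure nn_integral_distr)
  also have "\<dots> = (\<integral>\<^sup>+x. ennreal ((\<alpha> + 1) * (1 - x) powr \<alpha>) * g x * indicator {0..1} x \<partial>lborel)"
    by (simp add: distr_disc_area_norm_square nn_integral_uniform_measure divide_ennreal_def)
  finally show ?thesis .
qed

lemma emeasure_bergman_measure:
  assumes \<alpha>: "\<alpha> > -1"
  shows "emeasure (bergman_measure \<alpha>) UNIV = 1"
proof -
  have "emeasure (bergman_measure \<alpha>) UNIV = (\<integral>\<^sup>+z. (\<lambda>_. 1) ((norm z)\<^sup>2) \<partial>bergman_measure \<alpha>)"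
    by simp
  also have "\<dots> = (\<integral>\<^sup>+x. ennreal ((\<alpha> + 1) * (1 - x) powr \<alpha>) * indicator {0..1} x \<partial>lborel)"
    by (subst nn_integral_bergman_radial) simp_all
  \<comment> \<open>The reflection of x to 1 - x moves the possible singularity of the weight to 0,
    where the integral of a power is available; this is where \<alpha> > -1 enters.\<close>
  also have "\<dots> = (\<integral>\<^sup>+x. ennreal ((\<alpha> + 1) * x powr \<alpha>) * indicator {0..1} (1 - x) \<partial>lborel)"
    by (subst nn_integral_lborel_minus[where c = 1, symmetric]) simp_all
  also have "\<dots> = (\<integral>\<^sup>+x. ennreal ((\<alpha> + 1) * x powr \<alpha>) * indicator {0..1} x \<partial>lborel)"
    by (intro nn_integral_cong) (auto simp: indicator_def)
  also have "\<dots> = (\<integral>\<^sup>+x. ennreal ((\<alpha> + 1) * x powr \<alpha> * indicator {0..1} x) \<partial>lborel)"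
    by (intro nn_integral_cong) (auto simp: indicator_def)
  also have "\<dots> = ennreal 1"
  proof (rule nn_integral_has_integral_lborel)
    have "((\<lambda>x. (\<alpha> + 1) * x powr \<alpha>) has_integral 1) {0..1}"
      using has_integral_mult_right[OF has_integral_powr_from_0[OF \<alpha>, of 1], of "\<alpha> + 1"] \<alpha> by simp
    then show "((\<lambda>x. (\<alpha> + 1) * x powr \<alpha> * indicator {0..1} x) has_integral 1) UNIV"
      by (subst (asm) has_integral_restrict_UNIV[symmetric])
         (erule has_integral_eq[rotated], auto)
  qed (use \<alpha> in \<open>auto simp: indicator_def\<close>)
  finally show ?thesis by simp
qed

lemma finite_measure_bergman_measure: "\<alpha> > -1 \<Longrightarrow> finite_measure (bergman_measure \<alpha>)"
  by (intro finite_measureI) (simp add: emeasure_bergman_measure)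

text \<open>Rotation invariance is averaged over the angle and the integrals are exchanged. What
  remains inside is a mean over the circle through z, to which Parseval and subordination
  apply.\<close>

lemma nn_integral_bergman_circle_mean:
  assumes \<alpha>: "\<alpha> > -1" and [measurable]: "f \<in> borel_measurable borel"
  shows "(\<integral>\<^sup>+z. f z \<partial>bergman_measure \<alpha>) =
    (\<integral>\<^sup>+z. (\<integral>\<^sup>+t. f (z * circle_point t) * indicator {0..1} t \<partial>lborel) \<partial>bergman_measure \<alpha>)"
proof -
  interpret finite_measure "bergman_measure \<alpha>" using \<alpha> by (rule finite_measure_bergman_measure)
  interpret pair_sigma_finite "bergman_measure \<alpha>" "lborel :: real measure" ..
  have [measurable]: "circle_point \<in> borel_measurable borel"
    by (intro borel_measurable_continuous_onI continuous_on_circle_point continuous_on_id)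
  have "(\<integral>\<^sup>+z. f z \<partial>bergman_measure \<alpha>) = (\<integral>\<^sup>+t. (\<integral>\<^sup>+z. f z \<partial>bergman_measure \<alpha>) * indicator {0..1::real} t \<partial>lborel)"
    by (simp add: nn_integral_cmult)
  also have "\<dots> = (\<integral>\<^sup>+t. (\<integral>\<^sup>+z. f (z * circle_point t) * indicator {0..1} t \<partial>bergman_measure \<alpha>) \<partial>lborel)"
    by (simp add: nn_integral_multc nn_integral_bergman_rotation mult.commute[of _ "circle_point _"])
  also have "\<dots> = (\<integral>\<^sup>+z. (\<integral>\<^sup>+t. f (z * circle_point t) * indicator {0..1} t \<partial>lborel) \<partial>bergman_measure \<alpha>)"
    by (rule Fubini') simp
  finally show ?thesis .
qed

text \<open>Substitute y = 1 - c (1 - x): the weight contributes c^(-\<alpha>) and dx contributes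
  1/c. The image of [0,1] is only [1 - c, 1], hence an inequality. It serves both the lower bound on
  moments and the composition estimate.\<close>

lemma nn_integral_bergman_radial_dilation:
  assumes \<alpha>: "\<alpha> > -1" and c: "0 < c" "c \<le> 1" and [measurable]: "g \<in> borel_measurable borel"
  shows "(\<integral>\<^sup>+z. g (1 - c * (1 - (norm z)\<^sup>2)) \<partial>bergman_measure \<alpha>) \<le>
    ennreal (c powr - (\<alpha> + 1)) * (\<integral>\<^sup>+z. g ((norm z)\<^sup>2) \<partial>bergman_measure \<alpha>)"
proof -
  let ?f = "\<lambda>y. ennreal ((\<alpha> + 1) * (1 - y) powr \<alpha>) * g y * indicator {0..1} y"
  have "(\<integral>\<^sup>+z. g (1 - c * (1 - (norm z)\<^sup>2)) \<partial>bergman_measure \<alpha>) =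
      (\<integral>\<^sup>+x. ennreal ((\<alpha> + 1) * (1 - x) powr \<alpha>) * g (1 - c * (1 - x)) * indicator {0..1} x \<partial>lborel)"
    by (subst nn_integral_bergman_radial[where g = "\<lambda>x. g (1 - c * (1 - x))"]) simp_all
  also have "\<dots> \<le> (\<integral>\<^sup>+x. ennreal (c powr - \<alpha>) * ?f ((1 - c) + c * x) \<partial>lborel)"
  proof (intro nn_integral_mono)
    fix x :: real
    show "ennreal ((\<alpha> + 1) * (1 - x) powr \<alpha>) * g (1 - c * (1 - x)) * indicator {0..1} x
      \<le> ennreal (c powr - \<alpha>) * ?f ((1 - c) + c * x)"
    proof (cases "x \<in> {0..1}")
      case True
      then have x: "0 \<le> x" "x \<le> 1" by auto
      have "0 \<le> c * x" "c * x \<le> c" using x c by (auto simp: mult_left_le)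
      then have 1: "(1 - c) + c * x \<in> {0..1}" using c by auto
      have 2: "1 - ((1 - c) + c * x) = c * (1 - x)" by (simp add: algebra_simps)
      have 3: "(1 - c) + c * x = 1 - c * (1 - x)" by (simp add: algebra_simps)
      have "c powr - \<alpha> * ((\<alpha> + 1) * (c * (1 - x)) powr \<alpha>) = (\<alpha> + 1) * (1 - x) powr \<alpha>"
        unfolding powr_mult using c by (simp add: powr_minus)
      then have "ennreal ((\<alpha> + 1) * (1 - x) powr \<alpha>) =
          ennreal (c powr - \<alpha>) * ennreal ((\<alpha> + 1) * (1 - ((1 - c) + c * x)) powr \<alpha>)"
        unfolding 2 using \<alpha> by (subst ennreal_mult[symmetric]) auto
      then show ?thesis using True 1 unfolding 3 by (simp only: indicator_simps mult.assoc order_refl)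
    qed simp
  qed
  also have "\<dots> = ennreal (c powr - \<alpha>) * (\<integral>\<^sup>+x. ?f ((1 - c) + c * x) \<partial>lborel)"
    by (intro nn_integral_cmult) simp
  also have "c powr - \<alpha> = c powr - (\<alpha> + 1) * c"
    using c powr_add[of c "- (\<alpha> + 1)" 1] by simp
  also have "ennreal (c powr - (\<alpha> + 1) * c) * (\<integral>\<^sup>+x. ?f ((1 - c) + c * x) \<partial>lborel) =
      ennreal (c powr - (\<alpha> + 1)) * (ennreal \<bar>c\<bar> * (\<integral>\<^sup>+x. ?f ((1 - c) + c * x) \<partial>lborel))"
    using c by (simp add: ennreal_mult mult.assoc)
  also have "ennreal \<bar>c\<bar> * (\<integral>\<^sup>+x. ?f ((1 - c) + c * x) \<partial>lborel) = (\<integral>\<^sup>+y. ?f y \<partial>lborel)"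
    by (rule nn_integral_real_affine[symmetric]) (use c in auto)
  also have "\<dots> = (\<integral>\<^sup>+z. g ((norm z)\<^sup>2) \<partial>bergman_measure \<alpha>)"
    by (rule nn_integral_bergman_radial[symmetric]) simp
  finally show ?thesis .
qed

section \<open>Power series and moments\<close>

definition disc_series :: "(nat \<Rightarrow> complex) \<Rightarrow> (complex \<Rightarrow> complex) \<Rightarrow> bool" where
  "disc_series a f \<longleftrightarrow> (\<forall>z\<in>unit_disc. (\<lambda>n. a n * z ^ n) sums f z)"

lemma disc_series_exists:
  assumes "f holomorphic_on unit_disc"
  obtains a where "disc_series a f"
proof
  show "disc_series (\<lambda>n. (deriv ^^ n) f 0 / fact n) f"
    unfolding disc_series_def
  proof
    fix z assume "z \<in> unit_disc"
    from holomorphic_power_series[OF assms this]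
    show "(\<lambda>n. (deriv ^^ n) f 0 / fact n * z ^ n) sums f z" by simp
  qed
qed

lemma disc_series_holomorphic: "disc_series a f \<Longrightarrow> f holomorphic_on unit_disc"
  by (rule power_series_holomorphic[of 0 1 a]) (auto simp: disc_series_def)

lemma disc_series_summable:
  assumes "disc_series a f" "norm z < 1"
  shows "summable (\<lambda>n. norm (a n * z ^ n))"
proof -
  obtain r where r: "norm z < r" "r < 1" using dense[OF assms(2)] by auto
  have "summable (\<lambda>n. a n * of_real r ^ n)"
    using assms(1)[unfolded disc_series_def, rule_format, of "of_real r", THEN sums_summable]
      r norm_ge_zero[of z] by simp
  then show ?thesis by (rule powser_insidea) (use r norm_ge_zero[of z] in simp)
qed

text \<open>Parseval with coefficients \<open>a n * z ^ n\<close>. Writing the result in powers of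
  |z|^2 prepares the radial integration.\<close>

lemma circle_integral_disc_series:
  assumes f: "disc_series a f" and z: "norm z < 1"
  shows "((\<lambda>t. (norm (f (z * circle_point t)))\<^sup>2) has_integral (\<Sum>n. (norm (a n))\<^sup>2 * ((norm z)\<^sup>2) ^ n)) {0..1}"
    and "summable (\<lambda>n. (norm (a n))\<^sup>2 * ((norm z)\<^sup>2) ^ n)"
proof -
  have eq: "f (z * circle_point t) = (\<Sum>n. a n * z ^ n * circle_point t ^ n)" for t
    using f[unfolded disc_series_def, rule_format, of "z * circle_point t"] z
    by (intro sums_unique) (simp add: norm_mult power_mult_distrib mult.assoc)
  have eq2: "(norm (a n * z ^ n))\<^sup>2 = (norm (a n))\<^sup>2 * ((norm z)\<^sup>2) ^ n" for n
    by (simp add: norm_mult norm_power power_mult_distrib flip: power_mult) (simp add: mult.commute)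
  note P = Parseval_circle[OF disc_series_summable[OF f z]]
  show "((\<lambda>t. (norm (f (z * circle_point t)))\<^sup>2) has_integral (\<Sum>n. (norm (a n))\<^sup>2 * ((norm z)\<^sup>2) ^ n)) {0..1}"
    using P(1) by (simp only: eq eq2)
  show "summable (\<lambda>n. (norm (a n))\<^sup>2 * ((norm z)\<^sup>2) ^ n)"
    using P(2) by (simp only: eq2)
qed

text \<open>The squared norm of the monomial of degree n, which for \<alpha> > -1 equals n!
  Gamma(\<alpha>+2) / Gamma(n+\<alpha>+2). The arguments below rest on bounds instead of this
  formula.\<close>

definition bergman_moment :: "real \<Rightarrow> nat \<Rightarrow> real" where
  "bergman_moment \<alpha> n = (LINT z|bergman_measure \<alpha>. ((norm z)\<^sup>2) ^ n)"

lemma integrable_bergman_moment: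
  assumes "\<alpha> > -1"
  shows "integrable (bergman_measure \<alpha>) (\<lambda>z. ((norm z)\<^sup>2) ^ n)"
proof -
  interpret finite_measure "bergman_measure \<alpha>" using assms by (rule finite_measure_bergman_measure)
  show ?thesis
    using AE_bergman_measure[of \<alpha>]
    by (intro integrable_const_bound[where B = 1]) (auto simp: power_le_one elim!: eventually_mono)
qed

lemma nn_integral_bergman_moment:
  assumes "\<alpha> > -1"
  shows "(\<integral>\<^sup>+z. ennreal (((norm z)\<^sup>2) ^ n) \<partial>bergman_measure \<alpha>) = ennreal (bergman_moment \<alpha> n)"
  unfolding bergman_moment_def by (rule nn_integral_eq_integral[OF integrable_bergman_moment[OF assms]]) simp

lemma bergman_moment_nonneg: "0 \<le> bergman_moment \<alpha> n"
  unfolding bergman_moment_def by (intro integral_nonneg_AE) simp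

lemma bergman_moment_0:
  assumes "\<alpha> > -1" shows "bergman_moment \<alpha> 0 = 1"
  using nn_integral_bergman_moment[OF assms, of 0] emeasure_bergman_measure[OF assms] bergman_moment_nonneg[of \<alpha> 0]
  by simp

lemma bergman_moment_le_1:
  assumes "\<alpha> > -1" shows "bergman_moment \<alpha> n \<le> 1"
proof -
  have "bergman_moment \<alpha> n \<le> bergman_moment \<alpha> 0"
    unfolding bergman_moment_def using AE_bergman_measure[of \<alpha>]
    by (intro integral_mono_AE integrable_bergman_moment[OF assms]) (auto simp: power_le_one elim!: eventually_mono)
  then show ?thesis by (simp add: bergman_moment_0[OF assms])
qed

text \<open>Since 1 - c is at most 1 - c (1 - |z|^2), integrating n-th powers against total mass 1
  and undoing the dilation gives the bound. As c is arbitrary, moments decay more slowly than any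
  geometric sequence, which later forces convergence of power series in the whole disc.\<close>

lemma bergman_moment_ge:
  assumes \<alpha>: "\<alpha> > -1" and c: "0 < c" "c \<le> 1"
  shows "c powr (\<alpha> + 1) * (1 - c) ^ n \<le> bergman_moment \<alpha> n"
proof -
  have "ennreal ((1 - c) ^ n) = (\<integral>\<^sup>+z. ennreal ((1 - c) ^ n) \<partial>bergman_measure \<alpha>)"
    using \<alpha> by (simp add: emeasure_bergman_measure)
  also have "\<dots> \<le> (\<integral>\<^sup>+z. ennreal ((1 - c * (1 - (norm z)\<^sup>2)) ^ n) \<partial>bergman_measure \<alpha>)"
  proof (rule nn_integral_mono_AE)
    show "AE z in bergman_measure \<alpha>. ennreal ((1 - c) ^ n) \<le> ennreal ((1 - c * (1 - (norm z)\<^sup>2)) ^ n)"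
    proof (intro always_eventually allI ennreal_leI power_mono)
      fix z :: complex
      have "c * (1 - (norm z)\<^sup>2) \<le> c * 1" using c by (intro mult_left_mono) auto
      then show "1 - c \<le> 1 - c * (1 - (norm z)\<^sup>2)" by simp
    qed (use c in simp)
  qed
  also have "\<dots> \<le> ennreal (c powr - (\<alpha> + 1)) * ennreal (bergman_moment \<alpha> n)"
    using nn_integral_bergman_radial_dilation[OF \<alpha> c, of "\<lambda>x. ennreal (x ^ n)"]
    by (simp add: nn_integral_bergman_moment[OF \<alpha>])
  finally have "(1 - c) ^ n \<le> c powr - (\<alpha> + 1) * bergman_moment \<alpha> n"
    by (subst (asm) ennreal_mult[symmetric]) (auto simp: bergman_moment_nonneg)
  then have "c powr (\<alpha> + 1) * (1 - c) ^ n \<le> c powr (\<alpha> + 1) * (c powr - (\<alpha> + 1) * bergman_moment \<alpha> n)"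
    by (intro mult_left_mono) auto
  also have "\<dots> = bergman_moment \<alpha> n"
    using c by (simp add: powr_minus del: minus_add_distrib)
  finally show ?thesis .
qed

lemma bergman_moment_pos:
  assumes "\<alpha> > -1" shows "0 < bergman_moment \<alpha> n"
  using bergman_moment_ge[OF assms, of "1/2" n] by (auto intro: less_le_trans[rotated])

lemma nn_integral_circle_disc_series:
  assumes f: "disc_series a f" and z: "norm z < 1"
  shows "(\<integral>\<^sup>+t. ennreal ((norm (f (z * circle_point t)))\<^sup>2) * indicator {0..1} t \<partial>lborel) =
    (\<Sum>n. ennreal ((norm (a n))\<^sup>2) * ennreal (((norm z)\<^sup>2) ^ n))"
proof -
  have "(\<integral>\<^sup>+t. ennreal ((norm (f (z * circle_point t)))\<^sup>2) * indicator {0..1} t \<partial>lborel) =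
      ennreal (\<Sum>n. (norm (a n))\<^sup>2 * ((norm z)\<^sup>2) ^ n)"
    using nn_integral_has_integral_lebesgue[OF _ circle_integral_disc_series(1)[OF f z]]
    by (simp add: ennreal_mult' ennreal_indicator mult.commute)
  also have "\<dots> = (\<Sum>n. ennreal ((norm (a n))\<^sup>2 * ((norm z)\<^sup>2) ^ n))"
    by (rule suminf_ennreal2[symmetric]) (auto simp: circle_integral_disc_series(2)[OF f z])
  finally show ?thesis by (simp add: ennreal_mult)
qed

text \<open>Parseval on each circle, followed by termwise integration of nonnegative terms. Stated
  in \<open>ennreal\<close>, it needs no finiteness and serves in both directions: from membership
  to summability and back.\<close>

lemma nn_integral_bergman_series:
  assumes \<alpha>: "\<alpha> > -1" and f: "disc_series a f" and [measurable]: "f \<in> borel_measurable borel"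
  shows "(\<integral>\<^sup>+z. ennreal ((norm (f z))\<^sup>2) \<partial>bergman_measure \<alpha>) =
    (\<Sum>n. ennreal ((norm (a n))\<^sup>2) * ennreal (bergman_moment \<alpha> n))"
proof -
  have "(\<integral>\<^sup>+z. ennreal ((norm (f z))\<^sup>2) \<partial>bergman_measure \<alpha>) =
      (\<integral>\<^sup>+z. (\<Sum>n. ennreal ((norm (a n))\<^sup>2) * ennreal (((norm z)\<^sup>2) ^ n)) \<partial>bergman_measure \<alpha>)"
    using AE_bergman_measure[of \<alpha>]
    by (subst nn_integral_bergman_circle_mean[OF \<alpha>], simp)
       (intro nn_integral_cong_AE, auto simp: nn_integral_circle_disc_series[OF f] elim!: eventually_mono)
  also have "\<dots> = (\<Sum>n. ennreal ((norm (a n))\<^sup>2) * ennreal (bergman_moment \<alpha> n))"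
    by (simp add: nn_integral_suminf nn_integral_cmult nn_integral_bergman_moment[OF \<alpha>] del: ennreal_power)
  finally show ?thesis .
qed

lemma borel_measurable_disc_function:
  assumes "f holomorphic_on unit_disc" "\<And>z. z \<notin> unit_disc \<Longrightarrow> f z = 0"
  shows "f \<in> borel_measurable borel"
proof -
  have "(\<lambda>z. if z \<in> unit_disc then f z else 0) \<in> borel_measurable borel"
    by (intro borel_measurable_continuous_on_if holomorphic_on_imp_continuous_on assms) auto
  also have "(\<lambda>z. if z \<in> unit_disc then f z else 0) = f" using assms(2) by auto
  finally show ?thesis .
qed

section \<open>Boundedness of composition operators\<close>

text \<open>The disc automorphism sending a = \<Phi>(0) to 0 reduces this to the Schwarz lemma. The
  identity \<open>id\<close> converts the resulting bound into one for 1 - |\<Phi>(z)|^2 with factor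
  (1 - |a|) / (1 + |a|).\<close>

lemma Schwarz_Pick_origin:
  assumes hol: "\<Phi> holomorphic_on unit_disc" and self: "\<Phi> ` unit_disc \<subseteq> unit_disc" and z: "norm z < 1"
  shows "(1 - (norm z)\<^sup>2) * ((1 - norm (\<Phi> 0)) / 2) < 1 - (norm (\<Phi> z))\<^sup>2"
proof -
  define a where "a = \<Phi> 0"
  have lt: "norm (\<Phi> w) < 1" if "norm w < 1" for w using self that by force
  then have a: "norm a < 1" by (simp add: a_def)
  have den: "1 - norm a \<le> norm (1 - cnj a * w)" if "norm w < 1" for w
  proof -
    have "norm (cnj a * w) \<le> norm a * 1"
      unfolding norm_mult complex_mod_cnj using that by (intro mult_left_mono) auto
    then show ?thesis using norm_triangle_ineq2[of 1 "cnj a * w"] by simp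
  qed
  have den0: "1 - cnj a * w \<noteq> 0" if "norm w < 1" for w using den[OF that] a by auto
  have id: "(norm (1 - cnj a * w))\<^sup>2 - (norm (w - a))\<^sup>2 = (1 - (norm a)\<^sup>2) * (1 - (norm w)\<^sup>2)" for w
    by (simp only: cmod_power2) (simp add: power2_eq_square algebra_simps)
  define g where "g w = (\<Phi> w - a) / (1 - cnj a * \<Phi> w)" for w
  have "norm (g z) \<le> norm z"
  proof (rule Schwarz_Lemma(1))
    show "g holomorphic_on ball 0 1"
      unfolding g_def using den0 lt by (intro holomorphic_intros hol) auto
    show "g 0 = 0" by (simp add: g_def a_def)
    fix w :: complex assume "norm w < 1"
    then have w: "norm (\<Phi> w) < 1" by (rule lt)
    have "0 < (1 - (norm a)\<^sup>2) * (1 - (norm (\<Phi> w))\<^sup>2)"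
      using a w by (intro mult_pos_pos) (auto simp: power_less_one_iff abs_square_less_1)
    then have "(norm (\<Phi> w - a))\<^sup>2 < (norm (1 - cnj a * \<Phi> w))\<^sup>2" using id[of "\<Phi> w"] by linarith
    then have "norm (\<Phi> w - a) < norm (1 - cnj a * \<Phi> w)" by (rule power_less_imp_less_base) simp
    then show "norm (g w) < 1" using den0[OF w] by (simp add: g_def norm_divide)
  qed (rule z)
  define w where "w = \<Phi> z"
  have w: "norm w < 1" using lt z by (simp add: w_def)
  have "norm (w - a) \<le> norm z * norm (1 - cnj a * w)"
    using \<open>norm (g z) \<le> norm z\<close> den0[OF w] by (simp add: g_def norm_divide w_def divide_le_eq)
  then have "(norm (w - a))\<^sup>2 \<le> (norm z)\<^sup>2 * (norm (1 - cnj a * w))\<^sup>2"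
    by (simp add: power_mono flip: power_mult_distrib)
  then have 1: "(1 - (norm z)\<^sup>2) * (norm (1 - cnj a * w))\<^sup>2 \<le> (1 - (norm a)\<^sup>2) * (1 - (norm w)\<^sup>2)"
    using id[of w] by (simp add: algebra_simps)
  have z2: "0 < 1 - (norm z)\<^sup>2" using z by (simp add: abs_square_less_1)
  have "(1 - (norm z)\<^sup>2) * (1 - norm a)\<^sup>2 \<le> (1 - (norm z)\<^sup>2) * (norm (1 - cnj a * w))\<^sup>2"
    using z2 den[OF w] a by (intro mult_left_mono power_mono) auto
  also note 1
  also have "(1 - (norm a)\<^sup>2) * (1 - (norm w)\<^sup>2) = (1 - norm a) * ((1 + norm a) * (1 - (norm w)\<^sup>2))"
    by (simp add: power2_eq_square algebra_simps)
  finally have "(1 - norm a) * ((1 - (norm z)\<^sup>2) * (1 - norm a)) \<le> (1 - norm a) * ((1 + norm a) * (1 - (norm w)\<^sup>2))"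
    by (simp add: power2_eq_square mult_ac)
  then have "(1 - (norm z)\<^sup>2) * (1 - norm a) \<le> (1 + norm a) * (1 - (norm w)\<^sup>2)"
    using a by simp
  \<comment> \<open>Replacing 1 + |a| by 2 makes the inequality strict, so that the image of a
    circle lies in an open disc of radius R.\<close>
  also have "\<dots> < 2 * (1 - (norm w)\<^sup>2)"
    using a w by (intro mult_strict_right_mono) (auto simp: abs_square_less_1)
  finally show ?thesis by (simp add: w_def a_def)
qed

text \<open>
  On the circle of radius \<open>|z|\<close> the values of \<open>\<Phi>\<close> stay strictly inside the disc of radius \<open>R\<close>, by
  Schwarz-Pick. The choice of \<open>R\<^sup>2\<close> (called \<open>R2\<close>) makes \<open>1 - R\<^sup>2\<close> a constant multiple of \<open>1 - |z|\<^sup>2\<close>,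
  so that the dilation estimate for radial integrals applies.
\<close>

lemma circle_composition_le:
  assumes f: "disc_series a f"
    and hol: "\<Phi> holomorphic_on unit_disc" and self: "\<Phi> ` unit_disc \<subseteq> unit_disc" and z: "norm z < 1"
  defines "A \<equiv> norm (\<Phi> 0)"
  defines "R2 \<equiv> 1 - (1 - A) / 2 * (1 - (norm z)\<^sup>2)"
  shows "(\<integral>\<^sup>+t. ennreal ((norm (f (\<Phi> (z * circle_point t))))\<^sup>2) * indicator {0..1} t \<partial>lborel) \<le>
    ennreal (4 / (1 - A)) * (\<Sum>n. ennreal ((norm (a n))\<^sup>2) * ennreal (R2 ^ n))"
proof -
  have lt: "norm (\<Phi> w) < 1" if "norm w < 1" for w using self that by force
  have A: "0 \<le> A" "A < 1" using lt by (auto simp: A_def)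
  have z2: "0 < 1 - (norm z)\<^sup>2" "1 - (norm z)\<^sup>2 \<le> 1" using z by (auto simp: abs_square_less_1)
  have R2: "(1 + A) / 2 \<le> R2" "R2 < 1"
  proof -
    have "(1 - A) / 2 * (1 - (norm z)\<^sup>2) \<le> (1 - A) / 2 * 1" using A z2 by (intro mult_left_mono) auto
    then show "(1 + A) / 2 \<le> R2" by (simp add: R2_def field_simps)
    show "R2 < 1" using A z2 by (simp add: R2_def)
  qed
  define R where "R = sqrt R2"
  have "0 < (1 + A) / 2" using A by simp
  then have R2pos: "0 < R2" using R2(1) by (rule less_le_trans)
  have R: "0 < R" "R < 1" "R\<^sup>2 = R2" using R2 R2pos by (auto simp: R_def)
  have "R * R \<le> R * 1" using R by (intro mult_left_mono) auto
  then have RA: "(1 + A) / 2 \<le> R" using R2 R(3) by (simp add: power2_eq_square)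
  have \<Phi>R: "norm (\<Phi> (z * u)) < R" if "norm u \<le> 1" for u
  proof -
    have "norm z * norm u \<le> norm z * 1" using that by (intro mult_left_mono) auto
    then have zu: "norm (z * u) \<le> norm z" by (simp add: norm_mult)
    then have "(1 - (norm z)\<^sup>2) * ((1 - A) / 2) \<le> (1 - (norm (z * u))\<^sup>2) * ((1 - A) / 2)"
      using A by (intro mult_right_mono diff_left_mono power_mono) auto
    also have "\<dots> < 1 - (norm (\<Phi> (z * u)))\<^sup>2"
      using Schwarz_Pick_origin[OF hol self, of "z * u"] zu z by (simp add: A_def)
    finally have "(norm (\<Phi> (z * u)))\<^sup>2 < R\<^sup>2" by (simp add: R(3) R2_def mult.commute)
    then show ?thesis by (rule power_less_imp_less_base) (use R in simp)
  qed
  \<comment> \<open>Rescaling by R makes the outer function holomorphic on the closed unit disc and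
    the inner one a map of it into the open disc, while \<open>g\<close> after \<open>\<phi>\<close>
    is still f after \<Phi> on the original circle.\<close>
  define g where "g v = f (of_real R * v)" for v
  define \<phi> where "\<phi> u = \<Phi> (z * u) / of_real R" for u
  have fhol: "f holomorphic_on unit_disc" using f by (rule disc_series_holomorphic)
  have scale: "norm (c * u) < 1" if "norm c < 1" "norm u \<le> 1" for c u :: complex
  proof -
    have "norm c * norm u \<le> norm c * 1" using that by (intro mult_left_mono) auto
    then show ?thesis using that by (simp add: norm_mult)
  qed
  have ghol: "g holomorphic_on cball 0 1"
    unfolding g_def
    by (rule holomorphic_on_compose_gen[OF _ fhol, unfolded o_def])
       (use R scale[of "of_real R"] in \<open>auto intro!: holomorphic_intros\<close>)
  have \<phi>hol: "\<phi> holomorphic_on cball 0 1"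
    unfolding \<phi>_def
    by (intro holomorphic_intros holomorphic_on_compose_gen[OF _ hol, unfolded o_def])
       (use R scale[OF z] in auto)
  have \<phi>1: "norm (\<phi> u) < 1" if "norm u \<le> 1" for u
    using \<Phi>R[OF that] R by (simp add: \<phi>_def norm_divide)
  \<comment> \<open>R varies with z, but the subordination constant must not. As R is at least (1 +
    A) / 2, A / R is at most 1 - (1 - A) / (1 + A), hence at most 1 - (1 - A) / 2.\<close>
  have K: "2 / (1 - norm (\<phi> 0)) \<le> 4 / (1 - A)"
  proof -
    have "norm (\<phi> 0) = A / R" using R by (simp add: \<phi>_def norm_divide A_def)
    also have "\<dots> \<le> A / ((1 + A) / 2)" using A RA by (intro divide_left_mono) auto
    also have "\<dots> = 1 - (1 - A) / (1 + A)" using A by (simp add: field_simps)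
    also have "\<dots> \<le> 1 - (1 - A) / 2" using A by (intro diff_left_mono divide_left_mono) auto
    finally have "(1 - A) / 2 \<le> 1 - norm (\<phi> 0)" by linarith
    then have "2 / (1 - norm (\<phi> 0)) \<le> 2 / ((1 - A) / 2)"
      using A by (intro divide_left_mono mult_pos_pos) auto
    then show ?thesis by simp
  qed
  have fz: "((\<lambda>t. (norm (g (circle_point t)))\<^sup>2) has_integral (\<Sum>n. (norm (a n))\<^sup>2 * R2 ^ n)) {0..1}"
    and sR: "summable (\<lambda>n. (norm (a n))\<^sup>2 * R2 ^ n)"
    using circle_integral_disc_series[OF f, of "of_real R"] R by (auto simp: g_def)
  have gn: "0 \<le> (\<Sum>n. (norm (a n))\<^sup>2 * R2 ^ n)"
    using sR R2pos by (intro suminf_nonneg) auto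
  have comp: "f (\<Phi> (z * circle_point t)) = g (\<phi> (circle_point t))" for t
    using R by (simp add: g_def \<phi>_def)
  have int: "(\<lambda>t. (norm (g (\<phi> (circle_point t))))\<^sup>2) integrable_on {0..1}"
    by (intro integrable_continuous_real continuous_intros
          continuous_on_compose2[OF holomorphic_on_imp_continuous_on[OF ghol]]
          continuous_on_compose2[OF holomorphic_on_imp_continuous_on[OF \<phi>hol]])
       (use \<phi>1 in \<open>auto simp: less_imp_le\<close>)
  have "(\<integral>\<^sup>+t. ennreal ((norm (f (\<Phi> (z * circle_point t))))\<^sup>2) * indicator {0..1} t \<partial>lborel) =
      ennreal (integral {0..1} (\<lambda>t. (norm (g (\<phi> (circle_point t))))\<^sup>2))"
    using nn_integral_has_integral_lebesgue[OF _ integrable_integral[OF int]]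
    by (simp add: comp ennreal_mult' ennreal_indicator mult.commute)
  also have "\<dots> \<le> ennreal (4 / (1 - A) * (\<Sum>n. (norm (a n))\<^sup>2 * R2 ^ n))"
  proof (rule ennreal_leI)
    have "integral {0..1} (\<lambda>t. (norm (g (\<phi> (circle_point t))))\<^sup>2) \<le>
        2 / (1 - norm (\<phi> 0)) * (\<Sum>n. (norm (a n))\<^sup>2 * R2 ^ n)"
      using Littlewood_circle[OF ghol \<phi>hol \<phi>1] by (simp add: integral_unique[OF fz])
    also have "\<dots> \<le> 4 / (1 - A) * (\<Sum>n. (norm (a n))\<^sup>2 * R2 ^ n)"
      using K gn by (rule mult_right_mono)
    finally show "integral {0..1} (\<lambda>t. (norm (g (\<phi> (circle_point t))))\<^sup>2) \<le>
      4 / (1 - A) * (\<Sum>n. (norm (a n))\<^sup>2 * R2 ^ n)" .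
  qed
  also have "\<dots> = ennreal (4 / (1 - A)) * (\<Sum>n. ennreal ((norm (a n))\<^sup>2 * R2 ^ n))"
    using A gn R2pos sR by (subst suminf_ennreal2) (auto simp: ennreal_mult simp del: times_divide_eq_left)
  also have "(\<Sum>n. ennreal ((norm (a n))\<^sup>2 * R2 ^ n)) = (\<Sum>n. ennreal ((norm (a n))\<^sup>2) * ennreal (R2 ^ n))"
    using R2pos by (simp add: ennreal_mult)
  finally show ?thesis .
qed

text \<open>The factor 4 / (1 - A) is the price of subordination on each circle, the power of (1 -
  A) / 2 that of shrinking the larger radius back to |z| in the outer integral.\<close>

lemma nn_integral_composition_le:
  assumes \<alpha>: "\<alpha> > -1" and f: "disc_series a f" and [measurable]: "f \<in> borel_measurable borel"
    and hol: "\<Phi> holomorphic_on unit_disc" and self: "\<Phi> ` unit_disc \<subseteq> unit_disc"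
  defines "A \<equiv> norm (\<Phi> 0)"
  shows "(\<integral>\<^sup>+z. ennreal ((norm (composition_op \<Phi> f z))\<^sup>2) \<partial>bergman_measure \<alpha>) \<le>
    ennreal (4 / (1 - A) * ((1 - A) / 2) powr - (\<alpha> + 1)) *
    (\<integral>\<^sup>+z. ennreal ((norm (f z))\<^sup>2) \<partial>bergman_measure \<alpha>)"
proof -
  have A: "0 \<le> A" "A < 1" using self by (force simp: A_def)+
  have "composition_op \<Phi> f holomorphic_on unit_disc"
    by (rule holomorphic_transform[OF holomorphic_on_compose_gen[OF hol disc_series_holomorphic[OF f] self]])
       (simp add: composition_op_def)
  then have [measurable]: "composition_op \<Phi> f \<in> borel_measurable borel"
    by (rule borel_measurable_disc_function) (simp add: composition_op_def)
  let ?s = "\<lambda>x. \<Sum>n. ennreal ((norm (a n))\<^sup>2) * ennreal (x ^ n)"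
  have "(\<integral>\<^sup>+z. ennreal ((norm (composition_op \<Phi> f z))\<^sup>2) \<partial>bergman_measure \<alpha>) \<le>
      (\<integral>\<^sup>+z. ennreal (4 / (1 - A)) * ?s (1 - (1 - A) / 2 * (1 - (norm z)\<^sup>2)) \<partial>bergman_measure \<alpha>)"
  proof (subst nn_integral_bergman_circle_mean[OF \<alpha>], simp, rule nn_integral_mono_AE)
    show "AE z in bergman_measure \<alpha>.
      (\<integral>\<^sup>+t. ennreal ((norm (composition_op \<Phi> f (z * circle_point t)))\<^sup>2) * indicator {0..1} t \<partial>lborel)
      \<le> ennreal (4 / (1 - A)) * ?s (1 - (1 - A) / 2 * (1 - (norm z)\<^sup>2))"
      using AE_bergman_measure
    proof eventually_elim
      case (elim z)
      then have z: "norm z < 1" by simp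
      then have "composition_op \<Phi> f (z * circle_point t) = f (\<Phi> (z * circle_point t))" for t
        by (simp add: composition_op_def norm_mult)
      then show ?case using circle_composition_le[OF f hol self z] by (simp only: A_def)
    qed
  qed
  also have "\<dots> = ennreal (4 / (1 - A)) * (\<integral>\<^sup>+z. ?s (1 - (1 - A) / 2 * (1 - (norm z)\<^sup>2)) \<partial>bergman_measure \<alpha>)"
    by (rule nn_integral_cmult) simp
  also have "\<dots> \<le> ennreal (4 / (1 - A)) *
      (ennreal (((1 - A) / 2) powr - (\<alpha> + 1)) * (\<integral>\<^sup>+z. ?s ((norm z)\<^sup>2) \<partial>bergman_measure \<alpha>))"
    using A by (intro mult_left_mono nn_integral_bergman_radial_dilation[OF \<alpha>, where g = ?s]) auto
  also have "(\<integral>\<^sup>+z. ?s ((norm z)\<^sup>2) \<partial>bergman_measure \<alpha>) =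
      (\<integral>\<^sup>+z. ennreal ((norm (f z))\<^sup>2) \<partial>bergman_measure \<alpha>)"
    by (simp add: nn_integral_bergman_series[OF \<alpha> f] nn_integral_suminf nn_integral_cmult
          nn_integral_bergman_moment[OF \<alpha>] del: ennreal_power)
  finally show ?thesis using A by (subst ennreal_mult) (simp_all add: mult.assoc)
qed

section \<open>The Hilbert space structure\<close>

lemma bergman_spaceD:
  assumes "f \<in> bergman_space \<alpha>"
  shows "f holomorphic_on unit_disc" "z \<notin> unit_disc \<Longrightarrow> f z = 0"
    "integrable (bergman_measure \<alpha>) (\<lambda>z. (norm (f z))\<^sup>2)" "f \<in> borel_measurable borel"
  using assms borel_measurable_disc_function[of f] by (auto simp: bergman_space_def)

lemma bergman_spaceI:
  assumes "f holomorphic_on unit_disc" "\<And>z. z \<notin> unit_disc \<Longrightarrow> f z = 0"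
    and "(\<integral>\<^sup>+z. ennreal ((norm (f z))\<^sup>2) \<partial>bergman_measure \<alpha>) < \<infinity>"
  shows "f \<in> bergman_space \<alpha>"
proof -
  have [measurable]: "f \<in> borel_measurable borel"
    using assms(1,2) by (rule borel_measurable_disc_function)
  show ?thesis
    using assms by (auto simp: bergman_space_def intro!: integrableI_nonneg)
qed

lemma bergman_space_add_scaled:
  assumes f: "f \<in> bergman_space \<alpha>" and g: "g \<in> bergman_space \<alpha>"
  shows "(\<lambda>z. f z + c * g z) \<in> bergman_space \<alpha>"
proof -
  note [measurable] = bergman_spaceD(4)[OF f] bergman_spaceD(4)[OF g]
  have "integrable (bergman_measure \<alpha>) (\<lambda>z. (norm (f z + c * g z))\<^sup>2)"
  proof (rule Bochner_Integration.integrable_bound)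
    show "integrable (bergman_measure \<alpha>) (\<lambda>z. 2 * (norm (f z))\<^sup>2 + 2 * (norm c)\<^sup>2 * (norm (g z))\<^sup>2)"
      by (intro Bochner_Integration.integrable_add integrable_mult_right
          bergman_spaceD(3)[OF f] bergman_spaceD(3)[OF g])
    have "(norm (f z + c * g z))\<^sup>2 \<le> 2 * (norm (f z))\<^sup>2 + 2 * (norm c)\<^sup>2 * (norm (g z))\<^sup>2" for z
    proof -
      have "(norm (f z + c * g z))\<^sup>2 \<le> (norm (f z) + norm (c * g z))\<^sup>2"
        by (intro power_mono norm_triangle_ineq) simp
      also have "\<dots> \<le> 2 * (norm (f z))\<^sup>2 + 2 * (norm (c * g z))\<^sup>2"
        using sum_squares_bound[of "norm (f z)" "norm (c * g z)"] by (simp add: power2_sum)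
      finally show ?thesis by (simp add: norm_mult power_mult_distrib)
    qed
    then show "AE z in bergman_measure \<alpha>. norm ((norm (f z + c * g z))\<^sup>2)
        \<le> norm (2 * (norm (f z))\<^sup>2 + 2 * (norm c)\<^sup>2 * (norm (g z))\<^sup>2)"
      by (intro always_eventually allI) simp
  qed simp
  then show ?thesis
    using bergman_spaceD(1,2)[OF f] bergman_spaceD(1,2)[OF g]
    by (auto simp: bergman_space_def intro!: holomorphic_intros)
qed

lemma zero_in_bergman_space: "(\<lambda>_. 0) \<in> bergman_space \<alpha>"
  by (simp add: bergman_space_def)

lemma bergman_norm_nonneg: "0 \<le> bergman_norm \<alpha> f"
  by (simp add: bergman_norm_def)

lemma bergman_norm_square:
  "(bergman_norm \<alpha> f)\<^sup>2 = (LINT z|bergman_measure \<alpha>. (norm (f z))\<^sup>2)"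
  by (simp add: bergman_norm_def integral_nonneg_AE)

lemma nn_integral_bergman_norm:
  assumes "f \<in> bergman_space \<alpha>"
  shows "(\<integral>\<^sup>+z. ennreal ((norm (f z))\<^sup>2) \<partial>bergman_measure \<alpha>) = ennreal ((bergman_norm \<alpha> f)\<^sup>2)"
  unfolding bergman_norm_square
  by (rule nn_integral_eq_integral[OF bergman_spaceD(3)[OF assms]]) simp

lemma integrable_bergman_inner:
  assumes f: "f \<in> bergman_space \<alpha>" and g: "g \<in> bergman_space \<alpha>"
  shows "integrable (bergman_measure \<alpha>) (\<lambda>z. f z * cnj (g z))"
proof (rule Bochner_Integration.integrable_bound)
  note [measurable] = bergman_spaceD(4)[OF f] bergman_spaceD(4)[OF g]
  show "integrable (bergman_measure \<alpha>) (\<lambda>z. (norm (f z))\<^sup>2 + (norm (g z))\<^sup>2)"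
    by (intro Bochner_Integration.integrable_add bergman_spaceD(3)[OF f] bergman_spaceD(3)[OF g])
  show "AE z in bergman_measure \<alpha>. norm (f z * cnj (g z)) \<le> norm ((norm (f z))\<^sup>2 + (norm (g z))\<^sup>2)"
  proof (intro always_eventually allI)
    fix z
    have "2 * (norm (f z) * norm (g z)) \<le> (norm (f z))\<^sup>2 + (norm (g z))\<^sup>2"
      using sum_squares_bound[of "norm (f z)" "norm (g z)"] by simp
    moreover have "0 \<le> norm (f z) * norm (g z)" by simp
    ultimately show "norm (f z * cnj (g z)) \<le> norm ((norm (f z))\<^sup>2 + (norm (g z))\<^sup>2)"
      unfolding norm_mult complex_mod_cnj real_norm_def by linarith
  qed
  have [measurable]: "cnj \<in> borel_measurable borel"
    by (intro borel_measurable_continuous_onI continuous_intros)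
  show "(\<lambda>z. f z * cnj (g z)) \<in> borel_measurable (bergman_measure \<alpha>)" by measurable
qed

lemma bergman_inner_add_scaled:
  assumes "f \<in> bergman_space \<alpha>" "g \<in> bergman_space \<alpha>" "h \<in> bergman_space \<alpha>"
  shows "bergman_inner \<alpha> (\<lambda>z. f z + c * g z) h = bergman_inner \<alpha> f h + c * bergman_inner \<alpha> g h"
  unfolding bergman_inner_def
  using assms by (simp add: distrib_right mult.assoc integrable_bergman_inner)

lemma bergman_inner_commute: "bergman_inner \<alpha> g f = cnj (bergman_inner \<alpha> f g)"
proof -
  have "(\<lambda>z. g z * cnj (f z)) = (\<lambda>z. cnj (f z * cnj (g z)))" by (simp add: mult.commute)
  then show ?thesis by (simp only: bergman_inner_def Bochner_Integration.integral_cnj)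
qed

lemma bergman_inner_Cauchy_Schwarz:
  assumes f: "f \<in> bergman_space \<alpha>" and g: "g \<in> bergman_space \<alpha>"
  shows "norm (bergman_inner \<alpha> f g) \<le> bergman_norm \<alpha> f * bergman_norm \<alpha> g"
proof -
  note [measurable] = bergman_spaceD(4)[OF f] bergman_spaceD(4)[OF g]
  let ?I = "LINT z|bergman_measure \<alpha>. norm (f z * cnj (g z))"
  have I0: "0 \<le> ?I" by (intro integral_nonneg_AE) simp
  have "ennreal ?I = (\<integral>\<^sup>+z. ennreal (norm (f z)) * ennreal (norm (g z)) \<partial>bergman_measure \<alpha>)"
    using integrable_norm[OF integrable_bergman_inner[OF f g]]
    by (subst nn_integral_eq_integral[symmetric]) (auto simp: norm_mult ennreal_mult)
  then have "ennreal (?I\<^sup>2) = (\<integral>\<^sup>+z. ennreal (norm (f z)) * ennreal (norm (g z)) \<partial>bergman_measure \<alpha>)\<^sup>2"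
    using I0 by (simp flip: ennreal_power)
  also have "\<dots> \<le> (\<integral>\<^sup>+z. (ennreal (norm (f z)))\<^sup>2 \<partial>bergman_measure \<alpha>) *
      (\<integral>\<^sup>+z. (ennreal (norm (g z)))\<^sup>2 \<partial>bergman_measure \<alpha>)"
    by (rule Cauchy_Schwarz_nn_integral) simp_all
  also have "\<dots> = ennreal ((bergman_norm \<alpha> f)\<^sup>2 * (bergman_norm \<alpha> g)\<^sup>2)"
    by (simp add: ennreal_power nn_integral_bergman_norm[OF f] nn_integral_bergman_norm[OF g] ennreal_mult)
  finally have "?I\<^sup>2 \<le> (bergman_norm \<alpha> f * bergman_norm \<alpha> g)\<^sup>2"
    by (simp add: power_mult_distrib)
  then have "?I \<le> bergman_norm \<alpha> f * bergman_norm \<alpha> g"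
    by (rule power2_le_imp_le) (simp add: bergman_norm_nonneg)
  then show ?thesis
    unfolding bergman_inner_def by (rule order_trans[OF integral_norm_bound])
qed

lemma bergman_norm_add_scaled_square:
  assumes f: "f \<in> bergman_space \<alpha>" and g: "g \<in> bergman_space \<alpha>"
  shows "(bergman_norm \<alpha> (\<lambda>z. f z + c * g z))\<^sup>2 =
    (bergman_norm \<alpha> f)\<^sup>2 + (norm c)\<^sup>2 * (bergman_norm \<alpha> g)\<^sup>2 + 2 * Re (c * bergman_inner \<alpha> g f)"
proof -
  define k where "k z = Re (c * (g z * cnj (f z)))" for z
  have pt: "(norm (f z + c * g z))\<^sup>2 = (norm (f z))\<^sup>2 + (norm c)\<^sup>2 * (norm (g z))\<^sup>2 + 2 * k z" for z
    unfolding k_def by (simp only: cmod_power2) (simp add: power2_eq_square algebra_simps)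
  have int: "integrable (bergman_measure \<alpha>) (\<lambda>z. c * (g z * cnj (f z)))"
    by (intro integrable_mult_right integrable_bergman_inner f g)
  then have "Re (c * bergman_inner \<alpha> g f) = (LINT z|bergman_measure \<alpha>. k z)"
    unfolding bergman_inner_def k_def by (simp only: integral_Re integral_mult_right_zero)
  moreover have "integrable (bergman_measure \<alpha>) k"
    unfolding k_def using int by (rule integrable_Re)
  ultimately show ?thesis
    unfolding bergman_norm_square pt using bergman_spaceD(3)[OF f] bergman_spaceD(3)[OF g]
    by simp
qed

lemma disc_series_add_scaled:
  assumes "disc_series a f" "disc_series b g"
  shows "disc_series (\<lambda>n. a n + c * b n) (\<lambda>z. f z + c * g z)"
  using assms unfolding disc_series_def
  by (auto simp: distrib_right mult.assoc intro!: sums_add sums_mult)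

lemma bergman_norm_series:
  assumes \<alpha>: "\<alpha> > -1" and f: "f \<in> bergman_space \<alpha>" and a: "disc_series a f"
  shows "(\<lambda>n. (norm (a n))\<^sup>2 * bergman_moment \<alpha> n) sums (bergman_norm \<alpha> f)\<^sup>2"
proof -
  have eq: "ennreal ((bergman_norm \<alpha> f)\<^sup>2) = (\<Sum>n. ennreal ((norm (a n))\<^sup>2 * bergman_moment \<alpha> n))"
    using nn_integral_bergman_series[OF \<alpha> a bergman_spaceD(4)[OF f]]
    by (simp add: nn_integral_bergman_norm[OF f] ennreal_mult bergman_moment_nonneg)
  have s: "summable (\<lambda>n. (norm (a n))\<^sup>2 * bergman_moment \<alpha> n)"
    by (rule summable_suminf_not_top) (simp_all add: bergman_moment_nonneg flip: eq)
  then have "ennreal ((bergman_norm \<alpha> f)\<^sup>2) = ennreal (\<Sum>n. (norm (a n))\<^sup>2 * bergman_moment \<alpha> n)"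
    unfolding eq by (intro suminf_ennreal2) (auto simp: bergman_moment_nonneg)
  then have "(bergman_norm \<alpha> f)\<^sup>2 = (\<Sum>n. (norm (a n))\<^sup>2 * bergman_moment \<alpha> n)"
    using s by (subst (asm) ennreal_inj) (auto simp: bergman_moment_nonneg intro!: suminf_nonneg)
  then show ?thesis using s by (simp add: summable_sums)
qed

lemma bergman_space_series:
  assumes \<alpha>: "\<alpha> > -1" and a: "disc_series a f" and off: "\<And>z. z \<notin> unit_disc \<Longrightarrow> f z = 0"
    and s: "summable (\<lambda>n. (norm (a n))\<^sup>2 * bergman_moment \<alpha> n)"
  shows "f \<in> bergman_space \<alpha>"
proof (rule bergman_spaceI)
  show hol: "f holomorphic_on unit_disc" using a by (rule disc_series_holomorphic)
  show "(\<integral>\<^sup>+z. ennreal ((norm (f z))\<^sup>2) \<partial>bergman_measure \<alpha>) < \<infinity>"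
    using ennreal_suminf_neq_top[OF s]
      nn_integral_bergman_series[OF \<alpha> a borel_measurable_disc_function[OF hol off]]
    by (simp add: ennreal_mult bergman_moment_nonneg less_top)
qed (rule off)

section \<open>Monomials, coefficients and representation of functionals\<close>

text \<open>Cut off outside the disc because elements of \<open>bergman_space\<close> vanish there;
  degree 0 gives the constant 1 of the space.\<close>

definition disc_power :: "nat \<Rightarrow> complex \<Rightarrow> complex" where
  "disc_power n z = (if z \<in> unit_disc then z ^ n else 0)"

lemma disc_series_disc_power: "disc_series (\<lambda>k. if k = n then 1 else 0) (disc_power n)"
proof -
  have "(\<lambda>k. (if k = n then 1 else 0) * z ^ k) sums z ^ n" for z :: complex
    using sums_single[of n "\<lambda>k. z ^ k"] by (simp add: if_distrib[of "\<lambda>x. x * _"] cong: if_cong)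
  then show ?thesis by (simp add: disc_series_def disc_power_def)
qed

lemma disc_power_in_bergman_space:
  assumes "\<alpha> > -1" shows "disc_power n \<in> bergman_space \<alpha>"
proof (rule bergman_space_series[OF assms disc_series_disc_power])
  show "summable (\<lambda>k. (norm (if k = n then 1 else 0 :: complex))\<^sup>2 * bergman_moment \<alpha> k)"
    by (rule summable_finite[of "{n}"]) auto
qed (simp add: disc_power_def)

lemma bergman_norm_disc_power:
  assumes "\<alpha> > -1" shows "(bergman_norm \<alpha> (disc_power n))\<^sup>2 = bergman_moment \<alpha> n"
proof -
  have "(\<lambda>k. (norm (if k = n then 1 else 0 :: complex))\<^sup>2 * bergman_moment \<alpha> k) =
      (\<lambda>k. if k = n then bergman_moment \<alpha> k else 0)"
    by auto
  then show ?thesis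
    using bergman_norm_series[OF assms disc_power_in_bergman_space[OF assms] disc_series_disc_power, of n]
      sums_single[of n "bergman_moment \<alpha>"]
    by (simp add: sums_unique2)
qed

text \<open>Polarization: the squared norm of f + c z^n is computed once from its coefficients, of
  which only the n-th changes, and once by expanding the square. No termwise integration against the
  monomial is needed.\<close>

lemma bergman_inner_disc_power:
  assumes \<alpha>: "\<alpha> > -1" and f: "f \<in> bergman_space \<alpha>" and a: "disc_series a f"
  shows "bergman_inner \<alpha> (disc_power n) f = cnj (a n) * bergman_moment \<alpha> n"
proof -
  note p = disc_power_in_bergman_space[OF \<alpha>, of n]
  have key: "Re (c * bergman_inner \<alpha> (disc_power n) f) = Re (c * cnj (a n)) * bergman_moment \<alpha> n" for c
  proof -
    let ?b = "\<lambda>k. a k + c * (if k = n then 1 else 0)"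
    have "(\<lambda>k. (norm (?b k))\<^sup>2 * bergman_moment \<alpha> k) sums (bergman_norm \<alpha> (\<lambda>z. f z + c * disc_power n z))\<^sup>2"
      by (rule bergman_norm_series[OF \<alpha> bergman_space_add_scaled[OF f p]
            disc_series_add_scaled[OF a disc_series_disc_power]])
    moreover have "(\<lambda>k. (norm (a k))\<^sup>2 * bergman_moment \<alpha> k +
        (if k = n then ((norm (a k + c))\<^sup>2 - (norm (a k))\<^sup>2) * bergman_moment \<alpha> k else 0)) sums
        ((bergman_norm \<alpha> f)\<^sup>2 + ((norm (a n + c))\<^sup>2 - (norm (a n))\<^sup>2) * bergman_moment \<alpha> n)"
      by (intro sums_add bergman_norm_series[OF \<alpha> f a] sums_single)
    moreover have "(\<lambda>k. (norm (a k))\<^sup>2 * bergman_moment \<alpha> k +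
        (if k = n then ((norm (a k + c))\<^sup>2 - (norm (a k))\<^sup>2) * bergman_moment \<alpha> k else 0)) =
        (\<lambda>k. (norm (?b k))\<^sup>2 * bergman_moment \<alpha> k)"
      by (auto simp: algebra_simps)
    ultimately have "(bergman_norm \<alpha> (\<lambda>z. f z + c * disc_power n z))\<^sup>2 =
        (bergman_norm \<alpha> f)\<^sup>2 + ((norm (a n + c))\<^sup>2 - (norm (a n))\<^sup>2) * bergman_moment \<alpha> n"
      by (simp only: sums_unique2)
    then have "(norm c)\<^sup>2 * bergman_moment \<alpha> n + 2 * Re (c * bergman_inner \<alpha> (disc_power n) f) =
        ((norm (a n + c))\<^sup>2 - (norm (a n))\<^sup>2) * bergman_moment \<alpha> n"
      using bergman_norm_add_scaled_square[OF f p, of c] by (simp add: bergman_norm_disc_power[OF \<alpha>])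
    also have "(norm (a n + c))\<^sup>2 - (norm (a n))\<^sup>2 = (norm c)\<^sup>2 + 2 * Re (c * cnj (a n))"
      by (simp only: cmod_power2) (simp add: power2_eq_square algebra_simps)
    finally show ?thesis by (simp add: algebra_simps)
  qed
  \<comment> \<open>The choices c = 1 and c = -i isolate the real and the imaginary part.\<close>
  show ?thesis
    using key[of 1] key[of "- \<i>"] by (simp add: complex_eq_iff)
qed

text \<open>Density of polynomials: subtracting a partial sum of the power series does not change
  the value of \<open>D\<close>, while the norm of the remainder tends to 0.\<close>

lemma bergman_functional_zero:
  assumes \<alpha>: "\<alpha> > -1"
    and lin: "\<And>f g c. f \<in> bergman_space \<alpha> \<Longrightarrow> g \<in> bergman_space \<alpha> \<Longrightarrow>
      D (\<lambda>z. f z + c * g z) = D f + c * D g"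
    and bd: "\<And>f. f \<in> bergman_space \<alpha> \<Longrightarrow> norm (D f) \<le> C * bergman_norm \<alpha> f"
    and zero: "\<And>n. D (disc_power n) = 0"
    and f: "f \<in> bergman_space \<alpha>"
  shows "D f = (0 :: complex)"
proof -
  obtain a where a: "disc_series a f"
    using bergman_spaceD(1)[OF f] by (rule disc_series_exists)
  define r where "r N z = f z - (\<Sum>n<N. a n * disc_power n z)" for N z
  have r: "r N \<in> bergman_space \<alpha> \<and> D (r N) = D f \<and> disc_series (\<lambda>n. if n < N then 0 else a n) (r N)" for N
  proof (induction N)
    case 0
    show ?case using f a by (simp add: r_def[abs_def])
  next
    case (Suc N)
    have eq: "r (Suc N) = (\<lambda>z. r N z + (- a N) * disc_power N z)"
      by (auto simp: r_def)
    have "(\<lambda>n. if n < Suc N then 0 else a n) =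
        (\<lambda>n. (if n < N then 0 else a n) + (- a N) * (if n = N then 1 else 0))"
      by (auto simp: fun_eq_iff less_Suc_eq)
    then have "disc_series (\<lambda>n. if n < Suc N then 0 else a n) (r (Suc N))"
      using disc_series_add_scaled[OF conjunct2[OF conjunct2[OF Suc]] disc_series_disc_power[of N], of "- a N"]
      by (simp only: eq)
    moreover have "r (Suc N) \<in> bergman_space \<alpha>"
      unfolding eq using Suc disc_power_in_bergman_space[OF \<alpha>] by (intro bergman_space_add_scaled) auto
    moreover have "D (r (Suc N)) = D f"
      unfolding eq using Suc disc_power_in_bergman_space[OF \<alpha>] by (subst lin) (auto simp: zero)
    ultimately show ?case by simp
  qed
  let ?x = "\<lambda>n. (norm (a n))\<^sup>2 * bergman_moment \<alpha> n"
  have x: "?x sums (bergman_norm \<alpha> f)\<^sup>2" by (rule bergman_norm_series[OF \<alpha> f a])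
  have nr: "bergman_norm \<alpha> (r N) = sqrt ((bergman_norm \<alpha> f)\<^sup>2 - (\<Sum>n<N. ?x n))" for N
  proof -
    have "(\<lambda>n. ?x n - (if n \<in> {..<N} then ?x n else 0)) sums ((bergman_norm \<alpha> f)\<^sup>2 - (\<Sum>n<N. ?x n))"
      by (intro sums_diff x sums_If_finite_set) simp
    moreover have "(\<lambda>n. ?x n - (if n \<in> {..<N} then ?x n else 0)) =
        (\<lambda>n. (norm (if n < N then 0 else a n))\<^sup>2 * bergman_moment \<alpha> n)"
      by auto
    moreover have "(\<lambda>n. (norm (if n < N then 0 else a n))\<^sup>2 * bergman_moment \<alpha> n) sums (bergman_norm \<alpha> (r N))\<^sup>2"
      using r[of N] by (intro bergman_norm_series[OF \<alpha>]) auto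
    ultimately have "(bergman_norm \<alpha> (r N))\<^sup>2 = (bergman_norm \<alpha> f)\<^sup>2 - (\<Sum>n<N. ?x n)"
      by (simp only: sums_unique2)
    then show ?thesis by (metis bergman_norm_nonneg real_sqrt_unique)
  qed
  have "(\<lambda>N. C * sqrt ((bergman_norm \<alpha> f)\<^sup>2 - (\<Sum>n<N. ?x n))) \<longlonglongrightarrow> C * sqrt ((bergman_norm \<alpha> f)\<^sup>2 - (bergman_norm \<alpha> f)\<^sup>2)"
    using x unfolding sums_def by (intro tendsto_mult tendsto_const tendsto_real_sqrt tendsto_diff)
  moreover have "norm (D f) \<le> C * sqrt ((bergman_norm \<alpha> f)\<^sup>2 - (\<Sum>n<N. ?x n))" for N
    using bd[of "r N"] r[of N] nr[of N] by simp
  ultimately have "norm (D f) \<le> C * sqrt ((bergman_norm \<alpha> f)\<^sup>2 - (bergman_norm \<alpha> f)\<^sup>2)"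
    by (intro LIMSEQ_le_const) auto
  then show ?thesis by simp
qed

text \<open>Positive moments let the inner products with monomials determine all coefficients, hence
  the function on the disc; off the disc both functions are 0.\<close>

lemma bergman_inner_eqD:
  assumes \<alpha>: "\<alpha> > -1" and h: "h \<in> bergman_space \<alpha>" and k: "k \<in> bergman_space \<alpha>"
    and eq: "\<And>n. bergman_inner \<alpha> (disc_power n) h = bergman_inner \<alpha> (disc_power n) k"
  shows "h = k"
proof
  fix z
  obtain a where a: "disc_series a h" using bergman_spaceD(1)[OF h] by (rule disc_series_exists)
  obtain b where b: "disc_series b k" using bergman_spaceD(1)[OF k] by (rule disc_series_exists)
  have "a n = b n" for n
    using eq[of n] bergman_moment_pos[OF \<alpha>, of n]
    by (simp add: bergman_inner_disc_power[OF \<alpha> h a] bergman_inner_disc_power[OF \<alpha> k b])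
  then have "a = b" by auto
  show "h z = k z"
  proof (cases "z \<in> unit_disc")
    case True
    then have "(\<lambda>n. a n * z ^ n) sums h z" "(\<lambda>n. a n * z ^ n) sums k z"
      using a b \<open>a = b\<close> unfolding disc_series_def by blast+
    then show ?thesis by (rule sums_unique2)
  qed (simp add: bergman_spaceD(2)[OF h] bergman_spaceD(2)[OF k])
qed

text \<open>For |z|^2 < q < 1 the moment bound with c = 1 - q makes |b_n|^2 q^n bounded, so the
  terms are dominated by a geometric series of ratio |z| / sqrt q.\<close>

lemma summable_bergman_moment_imp_power_series:
  fixes b :: "nat \<Rightarrow> complex"
  assumes \<alpha>: "\<alpha> > -1" and s: "summable (\<lambda>n. (norm (b n))\<^sup>2 * bergman_moment \<alpha> n)" and z: "norm z < 1"
  shows "summable (\<lambda>n. b n * z ^ n)"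
proof -
  obtain q where q: "(norm z)\<^sup>2 < q" "q < 1"
    using dense[of "(norm z)\<^sup>2" 1] z by (auto simp: abs_square_less_1)
  have q0: "0 < q" using q(1) by (meson le_less_trans zero_le_power2)
  define c where "c = 1 - q"
  have c: "0 < c" "c \<le> 1" "1 - c = q" using q q0 by (auto simp: c_def)
  obtain K where K: "norm ((norm (b n))\<^sup>2 * bergman_moment \<alpha> n) \<le> K" for n
    using summable_imp_Bseq[OF s] unfolding Bseq_def by auto
  define K' where "K' = K / c powr (\<alpha> + 1)"
  have bd: "(norm (b n))\<^sup>2 * q ^ n \<le> K'" for n
  proof -
    have "(norm (b n))\<^sup>2 * (c powr (\<alpha> + 1) * q ^ n) \<le> (norm (b n))\<^sup>2 * bergman_moment \<alpha> n"
      using bergman_moment_ge[OF \<alpha> c(1,2), of n] unfolding c(3) by (intro mult_left_mono) auto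
    also have "\<dots> \<le> K" using K[of n] by simp
    finally show ?thesis using c(1) by (simp add: K'_def pos_le_divide_eq mult_ac)
  qed
  have K'0: "0 \<le> K'" using bd[of 0] by (meson order_trans zero_le_power2 mult_nonneg_nonneg q0 less_imp_le zero_le_power)
  define s' where "s' = norm z / sqrt q"
  have s': "0 \<le> s'" "s' < 1"
    using q q0 by (auto simp: s'_def divide_less_eq real_less_rsqrt)
  have sq: "(x * y ^ n)\<^sup>2 = x\<^sup>2 * (y\<^sup>2) ^ n" for x y :: real and n
    by (simp add: power_mult_distrib power_mult[symmetric] mult.commute)
  have "norm (b n * z ^ n) \<le> sqrt K' * s' ^ n" for n
  proof (rule power2_le_imp_le)
    have "(norm (b n * z ^ n))\<^sup>2 = ((norm (b n))\<^sup>2 * q ^ n) * (s'\<^sup>2) ^ n"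
      using q0 by (simp add: s'_def norm_mult norm_power sq power_divide)
    also have "\<dots> \<le> K' * (s'\<^sup>2) ^ n" using bd by (intro mult_right_mono) auto
    also have "\<dots> = (sqrt K' * s' ^ n)\<^sup>2"
      using K'0 by (simp add: sq)
    finally show "(norm (b n * z ^ n))\<^sup>2 \<le> (sqrt K' * s' ^ n)\<^sup>2" .
  qed (use K'0 s' in simp)
  then show ?thesis
    by (intro summable_comparison_test'[OF summable_mult[OF summable_geometric, of s' "sqrt K'"]])
       (use s' in auto)
qed

text \<open>
  The representing vector is the power series with coefficients \<open>b\<^sub>n = cnj (L z\<^sup>n) / \<parallel>z\<^sup>n\<parallel>\<^sup>2\<close>; evaluating \<open>L\<close>
  at its partial sums bounds their norms by \<open>C\<close>.
\<close>

lemma bergman_Riesz: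
  assumes \<alpha>: "\<alpha> > -1"
    and lin: "\<And>f g c. f \<in> bergman_space \<alpha> \<Longrightarrow> g \<in> bergman_space \<alpha> \<Longrightarrow>
      L (\<lambda>z. f z + c * g z) = L f + c * L g"
    and bd: "\<And>f. f \<in> bergman_space \<alpha> \<Longrightarrow> norm (L f) \<le> C * bergman_norm \<alpha> f"
  shows "\<exists>!h. h \<in> bergman_space \<alpha> \<and> (\<forall>f\<in>bergman_space \<alpha>. L f = bergman_inner \<alpha> f h)"
proof -
  note p = disc_power_in_bergman_space[OF \<alpha>]
  \<comment> \<open>The conjugate compensates for the inner product being conjugate-linear in its
    second argument.\<close>
  define b where "b n = cnj (L (disc_power n)) / of_real (bergman_moment \<alpha> n)" for n
  have Lp: "L (disc_power n) = cnj (b n) * bergman_moment \<alpha> n" for n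
    using bergman_moment_pos[OF \<alpha>, of n] by (simp add: b_def)
  let ?x = "\<lambda>n. (norm (b n))\<^sup>2 * bergman_moment \<alpha> n"
  define P where "P N z = (\<Sum>n<N. b n * disc_power n z)" for N z
  have L0: "L (\<lambda>_. 0) = 0"
    using bd[OF zero_in_bergman_space] by (simp add: bergman_norm_def)
  have P: "P N \<in> bergman_space \<alpha> \<and> disc_series (\<lambda>n. if n < N then b n else 0) (P N) \<and>
      L (P N) = of_real (\<Sum>n<N. ?x n)" for N
  proof (induction N)
    case 0
    show ?case by (simp add: P_def[abs_def] zero_in_bergman_space disc_series_def L0)
  next
    case (Suc N)
    have eq: "P (Suc N) = (\<lambda>z. P N z + b N * disc_power N z)" by (auto simp: P_def)
    have "(\<lambda>n. if n < Suc N then b n else 0) =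
        (\<lambda>n. (if n < N then b n else 0) + b N * (if n = N then 1 else 0))"
      by (auto simp: fun_eq_iff less_Suc_eq)
    then have "disc_series (\<lambda>n. if n < Suc N then b n else 0) (P (Suc N))"
      using disc_series_add_scaled[OF conjunct1[OF conjunct2[OF Suc]] disc_series_disc_power[of N], of "b N"]
      by (simp only: eq)
    moreover have "P (Suc N) \<in> bergman_space \<alpha>"
      unfolding eq using Suc p by (intro bergman_space_add_scaled) auto
    moreover have "L (P (Suc N)) = of_real (\<Sum>n<Suc N. ?x n)"
      unfolding eq using Suc p by (subst lin) (auto simp: Lp complex_norm_square mult.assoc simp flip: of_real_power)
    ultimately show ?case by simp
  qed
  \<comment> \<open>At \<open>P N\<close> both the value of \<open>L\<close> and the squared norm
    equal the partial sum S, so S is at most C sqrt S and therefore at most C^2, independently of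
    N.\<close>
  have partial: "(\<Sum>n<N. ?x n) \<le> C\<^sup>2" for N
  proof -
    let ?S = "\<Sum>n<N. ?x n"
    have S0: "0 \<le> ?S" by (intro sum_nonneg) (simp add: bergman_moment_nonneg)
    have "(\<lambda>n. (norm (if n < N then b n else 0))\<^sup>2 * bergman_moment \<alpha> n) sums (bergman_norm \<alpha> (P N))\<^sup>2"
      using P[of N] by (intro bergman_norm_series[OF \<alpha>]) auto
    moreover have "(\<lambda>n. (norm (if n < N then b n else 0))\<^sup>2 * bergman_moment \<alpha> n) =
        (\<lambda>n. if n \<in> {..<N} then ?x n else 0)"
      by auto
    moreover have "(\<lambda>n. if n \<in> {..<N} then ?x n else 0) sums ?S"
      by (rule sums_If_finite_set) simp
    ultimately have nP: "(bergman_norm \<alpha> (P N))\<^sup>2 = ?S" by (simp only: sums_unique2)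
    have "L (P N) = of_real ?S" using P[of N] by blast
    then have "norm (L (P N)) = ?S" using S0 by (simp only: norm_of_real abs_of_nonneg)
    then have "?S \<le> C * bergman_norm \<alpha> (P N)" using bd[of "P N"] P[of N] by simp
    then have "?S\<^sup>2 \<le> (C * bergman_norm \<alpha> (P N))\<^sup>2" using S0 by (intro power_mono)
    then have le: "?S * ?S \<le> C\<^sup>2 * ?S" by (simp only: power_mult_distrib nP power2_eq_square[of ?S])
    show ?thesis
    proof (cases "?S = 0")
      case False
      with S0 have "0 < ?S" by linarith
      with le show ?thesis by (rule mult_right_le_imp_le)
    next
      case True
      then show ?thesis by (simp only: zero_le_power2)
    qed
  qed
  have sx: "summable ?x"
    by (rule summableI_nonneg_bounded[OF _ partial]) (simp add: bergman_moment_nonneg)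
  define h where "h z = (if z \<in> unit_disc then (\<Sum>n. b n * z ^ n) else 0)" for z
  have hb: "disc_series b h"
    using summable_bergman_moment_imp_power_series[OF \<alpha> sx] by (auto simp: disc_series_def h_def summable_sums)
  have h: "h \<in> bergman_space \<alpha>"
    by (rule bergman_space_series[OF \<alpha> hb _ sx]) (simp add: h_def)
  have rep: "L f = bergman_inner \<alpha> f h" if f: "f \<in> bergman_space \<alpha>" for f
  proof -
    \<comment> \<open>The difference is a bounded functional that vanishes on every monomial by the
      choice of \<open>b\<close>.\<close>
    have "L f - bergman_inner \<alpha> f h = 0"
    proof (rule bergman_functional_zero[OF \<alpha>, where D = "\<lambda>f. L f - bergman_inner \<alpha> f h"])
      fix f assume "f \<in> bergman_space \<alpha>"
      then have "norm (L f) + norm (bergman_inner \<alpha> f h) \<le>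
          C * bergman_norm \<alpha> f + bergman_norm \<alpha> f * bergman_norm \<alpha> h"
        by (intro add_mono bd bergman_inner_Cauchy_Schwarz h)
      then show "norm (L f - bergman_inner \<alpha> f h) \<le> (C + bergman_norm \<alpha> h) * bergman_norm \<alpha> f"
        using norm_triangle_ineq4[of "L f" "bergman_inner \<alpha> f h"] by (simp add: algebra_simps)
    qed (simp_all add: lin bergman_inner_add_scaled h f algebra_simps Lp bergman_inner_disc_power[OF \<alpha> h hb])
    then show ?thesis by simp
  qed
  show ?thesis
  proof (rule ex1I[of _ h])
    fix k assume k: "k \<in> bergman_space \<alpha> \<and> (\<forall>f\<in>bergman_space \<alpha>. L f = bergman_inner \<alpha> f k)"
    then show "k = h"
      using rep p h by (intro bergman_inner_eqD[OF \<alpha>]) auto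
  qed (use h rep in blast)
qed

section \<open>Composition operators, their adjoints and point evaluations\<close>

lemma composition_op_bergman:
  assumes \<alpha>: "\<alpha> > -1" and f: "f \<in> bergman_space \<alpha>"
    and hol: "\<Phi> holomorphic_on unit_disc" and self: "\<Phi> ` unit_disc \<subseteq> unit_disc"
  defines "K \<equiv> 4 / (1 - norm (\<Phi> 0)) * ((1 - norm (\<Phi> 0)) / 2) powr - (\<alpha> + 1)"
  shows "composition_op \<Phi> f \<in> bergman_space \<alpha>"
    and "bergman_norm \<alpha> (composition_op \<Phi> f) \<le> sqrt K * bergman_norm \<alpha> f"
proof -
  obtain a where a: "disc_series a f"
    using bergman_spaceD(1)[OF f] by (rule disc_series_exists)
  have "norm (\<Phi> 0) < 1" using self by force
  then have K: "0 \<le> K" by (simp add: K_def)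
  have le: "(\<integral>\<^sup>+z. ennreal ((norm (composition_op \<Phi> f z))\<^sup>2) \<partial>bergman_measure \<alpha>) \<le>
      ennreal (K * (bergman_norm \<alpha> f)\<^sup>2)"
    using nn_integral_composition_le[OF \<alpha> a bergman_spaceD(4)[OF f] hol self] K
    unfolding K_def[symmetric] nn_integral_bergman_norm[OF f] by (simp add: ennreal_mult)
  show mem: "composition_op \<Phi> f \<in> bergman_space \<alpha>"
  proof (rule bergman_spaceI)
    show "composition_op \<Phi> f holomorphic_on unit_disc"
      by (rule holomorphic_transform[OF holomorphic_on_compose_gen[OF hol bergman_spaceD(1)[OF f] self]])
         (simp add: composition_op_def)
  qed (use le in \<open>auto simp: composition_op_def intro: le_less_trans\<close>)
  have "(bergman_norm \<alpha> (composition_op \<Phi> f))\<^sup>2 \<le> K * (bergman_norm \<alpha> f)\<^sup>2"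
    using le K by (simp add: nn_integral_bergman_norm[OF mem])
  then have "(bergman_norm \<alpha> (composition_op \<Phi> f))\<^sup>2 \<le> (sqrt K * bergman_norm \<alpha> f)\<^sup>2"
    using K by (simp add: power_mult_distrib)
  then show "bergman_norm \<alpha> (composition_op \<Phi> f) \<le> sqrt K * bergman_norm \<alpha> f"
    by (rule power2_le_imp_le) (use K in \<open>simp add: bergman_norm_nonneg\<close>)
qed

text \<open>Cauchy-Schwarz and boundedness of composition make the functional f \<mapsto> <C f, g>
  bounded, and the unique representing vector from \<open>bergman_Riesz\<close> justifies the
  definite description.\<close>

lemma bergman_adjoint_composition_op:
  assumes \<alpha>: "\<alpha> > -1" and g: "g \<in> bergman_space \<alpha>"
    and hol: "\<Phi> holomorphic_on unit_disc" and self: "\<Phi> ` unit_disc \<subseteq> unit_disc"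
  defines "h \<equiv> bergman_adjoint \<alpha> (composition_op \<Phi>) g"
  shows "h \<in> bergman_space \<alpha>"
    and "f \<in> bergman_space \<alpha> \<Longrightarrow> bergman_inner \<alpha> (composition_op \<Phi> f) g = bergman_inner \<alpha> f h"
proof -
  obtain K where C: "composition_op \<Phi> f \<in> bergman_space \<alpha>"
    "bergman_norm \<alpha> (composition_op \<Phi> f) \<le> K * bergman_norm \<alpha> f" if "f \<in> bergman_space \<alpha>" for f
    using composition_op_bergman[OF \<alpha> _ hol self] by blast
  have "\<exists>!h. h \<in> bergman_space \<alpha> \<and>
      (\<forall>f\<in>bergman_space \<alpha>. bergman_inner \<alpha> (composition_op \<Phi> f) g = bergman_inner \<alpha> f h)"
  proof (rule bergman_Riesz[OF \<alpha>])
    fix f k c assume "f \<in> bergman_space \<alpha>" "k \<in> bergman_space \<alpha>"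
    moreover have "composition_op \<Phi> (\<lambda>z. f z + c * k z) =
        (\<lambda>z. composition_op \<Phi> f z + c * composition_op \<Phi> k z)"
      by (auto simp: composition_op_def)
    ultimately show "bergman_inner \<alpha> (composition_op \<Phi> (\<lambda>z. f z + c * k z)) g =
        bergman_inner \<alpha> (composition_op \<Phi> f) g + c * bergman_inner \<alpha> (composition_op \<Phi> k) g"
      by (simp add: bergman_inner_add_scaled C(1) g)
  next
    fix f assume f: "f \<in> bergman_space \<alpha>"
    have "norm (bergman_inner \<alpha> (composition_op \<Phi> f) g) \<le>
        bergman_norm \<alpha> (composition_op \<Phi> f) * bergman_norm \<alpha> g"
      by (rule bergman_inner_Cauchy_Schwarz[OF C(1)[OF f] g])
    also have "\<dots> \<le> K * bergman_norm \<alpha> f * bergman_norm \<alpha> g"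
      by (rule mult_right_mono[OF C(2)[OF f] bergman_norm_nonneg])
    finally show "norm (bergman_inner \<alpha> (composition_op \<Phi> f) g) \<le>
        (K * bergman_norm \<alpha> g) * bergman_norm \<alpha> f"
      by (simp add: mult_ac)
  qed
  from theI'[OF this] show "h \<in> bergman_space \<alpha>"
    and "f \<in> bergman_space \<alpha> \<Longrightarrow> bergman_inner \<alpha> (composition_op \<Phi> f) g = bergman_inner \<alpha> f h"
    unfolding h_def bergman_adjoint_def by blast+
qed

lemma bergman_inner_1_left:
  assumes \<alpha>: "\<alpha> > -1" and f: "f \<in> bergman_space \<alpha>"
  shows "bergman_inner \<alpha> (disc_power 0) f = cnj (f 0)"
proof -
  obtain a where a: "disc_series a f"
    using bergman_spaceD(1)[OF f] by (rule disc_series_exists)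
  then have "(\<lambda>n. a n * 0 ^ n) sums f 0" unfolding disc_series_def by (rule bspec) simp
  then have "f 0 = a 0" using powser_sums_zero by (rule sums_unique2)
  then show ?thesis by (simp add: bergman_inner_disc_power[OF \<alpha> f a] bergman_moment_0[OF \<alpha>])
qed

text \<open>With t = |w|^2 the test function has value 1 + t at w, and its squared norm is at most 1
  + t because the first moment is at most 1. Then (1 + t)^2 is at most 1 + t, so t = 0.\<close>

lemma evaluation_contractive_imp_zero:
  assumes \<alpha>: "\<alpha> > -1" and w: "norm w < 1"
    and contr: "\<And>f. f \<in> bergman_space \<alpha> \<Longrightarrow> norm (f w) \<le> bergman_norm \<alpha> f"
  shows "w = 0"
proof -
  note p = disc_power_in_bergman_space[OF \<alpha>]
  define f where "f z = disc_power 0 z + cnj w * disc_power 1 z" for z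
  have f: "f \<in> bergman_space \<alpha>" unfolding f_def by (intro bergman_space_add_scaled p)
  have "f w = of_real (1 + (norm w)\<^sup>2)"
    using w complex_norm_square[of w] by (simp add: f_def disc_power_def mult.commute)
  then have fw: "norm (f w) = 1 + (norm w)\<^sup>2"
    by (simp only: norm_of_real) simp
  have "bergman_inner \<alpha> (disc_power 1) (disc_power 0) = 0"
    by (simp add: bergman_inner_disc_power[OF \<alpha> p disc_series_disc_power])
  then have "(bergman_norm \<alpha> f)\<^sup>2 = 1 + (norm w)\<^sup>2 * bergman_moment \<alpha> 1"
    unfolding f_def
    by (subst bergman_norm_add_scaled_square[OF p p]) (simp add: bergman_norm_disc_power[OF \<alpha>] bergman_moment_0[OF \<alpha>])
  also have "\<dots> \<le> 1 + (norm w)\<^sup>2 * 1"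
    by (intro add_left_mono mult_left_mono bergman_moment_le_1[OF \<alpha>]) simp
  finally have "(norm (f w))\<^sup>2 \<le> 1 + (norm w)\<^sup>2"
    using power_mono[OF contr[OF f] norm_ge_zero, of 2] by simp
  moreover have "(norm (f w))\<^sup>2 = 1 + 2 * (norm w)\<^sup>2 + ((norm w)\<^sup>2)\<^sup>2"
    unfolding fw by (simp add: power2_sum)
  moreover have "0 \<le> ((norm w)\<^sup>2)\<^sup>2" by simp
  ultimately have "(norm w)\<^sup>2 \<le> 0" by linarith
  then show ?thesis by simp
qed

theorem corollary2p5:
  fixes \<alpha> :: real and \<Phi> \<Psi> :: "complex \<Rightarrow> complex"
  assumes "\<alpha> > -1"
    and "\<Phi> holomorphic_on unit_disc" and "\<Phi> ` unit_disc \<subseteq> unit_disc"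
    and "\<Psi> holomorphic_on unit_disc" and "\<Psi> ` unit_disc \<subseteq> unit_disc"
    and "bergman_isometry \<alpha> (bergman_adjoint \<alpha> (composition_op \<Phi>) \<circ> composition_op \<Psi>)"
  shows "\<Phi> 0 = 0 \<and> \<Psi> 0 = 0"
proof
  note \<alpha> = assms(1)
  let ?T = "\<lambda>f. bergman_adjoint \<alpha> (composition_op \<Phi>) (composition_op \<Psi> f)"
  note p = disc_power_in_bergman_space[OF \<alpha>, of 0]
  have p1: "bergman_norm \<alpha> (disc_power 0) = 1"
    using bergman_norm_disc_power[OF \<alpha>, of 0] bergman_norm_nonneg[of \<alpha> "disc_power 0"]
    by (simp add: bergman_moment_0[OF \<alpha>] power2_eq_1_iff)
  \<comment> \<open>The self-map property matters here: \<open>disc_power 0\<close> is 1 only on the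
    disc.\<close>
  have comp1: "composition_op \<Theta> (disc_power 0) = disc_power 0" if "\<Theta> ` unit_disc \<subseteq> unit_disc" for \<Theta>
    using that by (force simp: composition_op_def disc_power_def)
  have comp0: "composition_op \<Theta> f 0 = f (\<Theta> 0)" for \<Theta> f
    by (simp add: composition_op_def)
  have iso: "bergman_norm \<alpha> (?T f) = bergman_norm \<alpha> f" if "f \<in> bergman_space \<alpha>" for f
    using assms(6) that by (simp add: bergman_isometry_def)
  have \<Psi>: "composition_op \<Psi> f \<in> bergman_space \<alpha>" if "f \<in> bergman_space \<alpha>" for f
    using composition_op_bergman(1)[OF \<alpha> that assms(4,5)] .
  have \<Phi>: "composition_op \<Phi> f \<in> bergman_space \<alpha>" if "f \<in> bergman_space \<alpha>" for f
    using composition_op_bergman(1)[OF \<alpha> that assms(2,3)] .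
  note T = bergman_adjoint_composition_op[OF \<alpha> \<Psi> assms(2,3)]
  \<comment> \<open>Only the norm of T at the constant 1 is used here.\<close>
  show "\<Phi> 0 = 0"
  proof (rule evaluation_contractive_imp_zero[OF \<alpha>])
    show "norm (\<Phi> 0) < 1" using assms(3) by force
    fix f assume f: "f \<in> bergman_space \<alpha>"
    have "norm (f (\<Phi> 0)) = norm (bergman_inner \<alpha> (composition_op \<Phi> f) (disc_power 0))"
      by (subst bergman_inner_commute)
         (simp add: bergman_inner_1_left[OF \<alpha> \<Phi>[OF f]] comp0)
    also have "\<dots> = norm (bergman_inner \<alpha> f (?T (disc_power 0)))"
      using T(2)[OF p f] by (simp add: comp1[OF assms(5)])
    also have "\<dots> \<le> bergman_norm \<alpha> f * bergman_norm \<alpha> (?T (disc_power 0))"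
      by (rule bergman_inner_Cauchy_Schwarz[OF f T(1)[OF p]])
    finally show "norm (f (\<Phi> 0)) \<le> bergman_norm \<alpha> f"
      by (simp add: iso[OF p] p1)
  qed
  \<comment> \<open>Here the isometry is used at every f, since T f stands in the inner product
    against the constant 1.\<close>
  show "\<Psi> 0 = 0"
  proof (rule evaluation_contractive_imp_zero[OF \<alpha>])
    show "norm (\<Psi> 0) < 1" using assms(5) by force
    fix f assume f: "f \<in> bergman_space \<alpha>"
    have "norm (f (\<Psi> 0)) = norm (bergman_inner \<alpha> (disc_power 0) (composition_op \<Psi> f))"
      by (simp add: bergman_inner_1_left[OF \<alpha> \<Psi>[OF f]] comp0)
    also have "\<dots> = norm (bergman_inner \<alpha> (disc_power 0) (?T f))"
      using T(2)[OF f p] by (simp add: comp1[OF assms(3)])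
    also have "\<dots> \<le> bergman_norm \<alpha> (disc_power 0) * bergman_norm \<alpha> (?T f)"
      by (rule bergman_inner_Cauchy_Schwarz[OF p T(1)[OF f]])
    finally show "norm (f (\<Psi> 0)) \<le> bergman_norm \<alpha> f"
      by (simp add: iso[OF f] p1)
  qed
qed

end
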